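(* Let $(M^7,\omega)$ be a (not necessarily compact) $G_2$-manifold with closed fundamental form, $d\omega=0$, and induced metric $g$ with Levi-Civita connection $\nabla^g$. If $(M,\omega)$ is both Einstein (the traceless part of the Ricci tensor $\rho$ of $g$ vanishes) and $\star$-Einstein ($\rho^\star=\frac{s^\star}{7}g$), then $(M,\omega)$ is parallel, i.e. $\nabla^g\omega=0$.
   Context: A $G_2$-structure on a $7$-manifold $M$ is a differential three-form $\omega$ (the fundamental form) such that around every point there are local frames $e_1,\dots,e_7$ of the cotangent bundle with $\omega=e_{124}+e_{235}+e_{346}+e_{457}+e_{561}+e_{672}+e_{713}$, where $e_{ijk}=e_i\wedge e_j\wedge e_k$; the pair $(M,\omega)$ is a $G_2$-manifold. Declaring these frames orthonormal defines the induced metric $g$. Repeated indices are summed, components are with respect to an orthonormal frame, and $\omega=\frac16\omega_{ijk}e_{ijk}$. Curvature: $R_{X,Y}=[\nabla^g_X,\nabla^g_Y]-\nabla^g_{[X,Y]}$, $R_{sijk}=g(R(e_s,e_i)e_j,e_k)$, Ricci tensor $\rho_{ij}=R_{sijs}$. The $\star$-Ricci tensor is the symmetric tensor $\rho^\star_{sm}=R_{ijkl}\omega_{ijs}\omega_{klm}$ and $s^\star=\rho^\star_{ii}$ is its trace. *)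

theory Defs
  imports "HOL-Analysis.Analysis"
begin

section \<open>Smooth functions and manifolds\<close>

text \<open>For open \<open>S\<close> in a finite-dimensional space this is the class \<open>C\<^sup>k\<close>: all iterated
  directional derivatives up to order \<open>k\<close> exist, are Frechet differentiable (below order \<open>k\<close>)
  and continuous.\<close>

primrec Ck_on :: "nat \<Rightarrow> 'a::euclidean_space set \<Rightarrow> ('a \<Rightarrow> 'b::real_normed_vector) \<Rightarrow> bool" where
  "Ck_on 0 S f \<longleftrightarrow> continuous_on S f"
| "Ck_on (Suc k) S f \<longleftrightarrow>
     (\<forall>x\<in>S. f differentiable (at x)) \<and> (\<forall>u. Ck_on k S (\<lambda>x. frechet_derivative f (at x) u))"

definition smooth_on :: "'a::euclidean_space set \<Rightarrow> ('a \<Rightarrow> 'b::real_normed_vector) \<Rightarrow> bool" where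
  "smooth_on S f \<longleftrightarrow> (\<forall>k. Ck_on k S f)"

text \<open>A chart is a domain together with a coordinate map; the values of the map outside the
  domain are irrelevant.\<close>

type_synonym ('a, 'n) chart = "'a set \<times> ('a \<Rightarrow> real^'n)"

definition img :: "('a, 'n) chart \<Rightarrow> (real^'n) set" where
  "img c = snd c ` fst c"

definition chart_on :: "'a topology \<Rightarrow> ('a, 'n::finite) chart \<Rightarrow> bool" where
  "chart_on X c \<longleftrightarrow> openin X (fst c) \<and> open (img c) \<and>
     homeomorphic_map (subtopology X (fst c)) (top_of_set (img c)) (snd c)"

definition overlap :: "('a, 'n) chart \<Rightarrow> ('a, 'n) chart \<Rightarrow> (real^'n) set" where
  "overlap c d = snd c ` (fst c \<inter> fst d)"

definition transition :: "('a, 'n) chart \<Rightarrow> ('a, 'n) chart \<Rightarrow> real^'n \<Rightarrow> real^'n" where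
  "transition c d x = snd d (inv_into (fst c) (snd c) x)"

definition smooth_manifold :: "'a topology \<Rightarrow> ('a, 'n::finite) chart set \<Rightarrow> bool" where
  "smooth_manifold X A \<longleftrightarrow>
     Hausdorff_space X \<and> second_countable X \<and>
     (\<forall>c\<in>A. chart_on X c) \<and> \<Union>(fst ` A) = topspace X \<and>
     (\<forall>c\<in>A. \<forall>d\<in>A. smooth_on (overlap c d) (transition c d))"

section \<open>Tensor fields in charts\<close>

text \<open>Tensor fields are given by their coordinate representatives: for a chart \<open>c\<close> and a point
  \<open>x \<in> img c\<close>, \<open>T c x\<close> is a multilinear map on the coordinate tangent space, and the
  representatives in two charts are related by pullback along the transition map. Values at
  \<open>x \<notin> img c\<close> or \<open>c \<notin> A\<close> are irrelevant.\<close>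

abbreviation (input) D :: "(real^'n \<Rightarrow> 'b::real_normed_vector) \<Rightarrow> real^'n::finite \<Rightarrow> real^'n \<Rightarrow> 'b" where
  "D f x u \<equiv> frechet_derivative f (at x) u"

type_synonym ('a, 'n) tensor2 = "('a, 'n) chart \<Rightarrow> real^'n \<Rightarrow> real^'n \<Rightarrow> real^'n \<Rightarrow> real"
type_synonym ('a, 'n) tensor3 =
  "('a, 'n) chart \<Rightarrow> real^'n \<Rightarrow> real^'n \<Rightarrow> real^'n \<Rightarrow> real^'n \<Rightarrow> real"

definition riemannian_metric :: "('a, 'n::finite) chart set \<Rightarrow> ('a, 'n) tensor2 \<Rightarrow> bool" where
  "riemannian_metric A g \<longleftrightarrow>
     (\<forall>c\<in>A. \<forall>x\<in>img c. bilinear (g c x) \<and> (\<forall>u v. g c x u v = g c x v u) \<and>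
        (\<forall>u. u \<noteq> 0 \<longrightarrow> g c x u u > 0)) \<and>
     (\<forall>c\<in>A. \<forall>u v. smooth_on (img c) (\<lambda>x. g c x u v)) \<and>
     (\<forall>c\<in>A. \<forall>d\<in>A. \<forall>x\<in>overlap c d. \<forall>u v.
        g c x u v = g d (transition c d x) (D (transition c d) x u) (D (transition c d) x v))"

definition differential_3form :: "('a, 'n::finite) chart set \<Rightarrow> ('a, 'n) tensor3 \<Rightarrow> bool" where
  "differential_3form A \<omega> \<longleftrightarrow>
     (\<forall>c\<in>A. \<forall>x\<in>img c. \<forall>u v w. linear (\<lambda>t. \<omega> c x t v w) \<and>
        \<omega> c x v u w = - \<omega> c x u v w \<and> \<omega> c x u w v = - \<omega> c x u v w) \<and>
     (\<forall>c\<in>A. \<forall>u v w. smooth_on (img c) (\<lambda>x. \<omega> c x u v w)) \<and>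
     (\<forall>c\<in>A. \<forall>d\<in>A. \<forall>x\<in>overlap c d. \<forall>u v w.
        \<omega> c x u v w = \<omega> d (transition c d x)
          (D (transition c d) x u) (D (transition c d) x v) (D (transition c d) x w))"

text \<open>The exterior derivative, evaluated on constant (hence commuting) coordinate vector fields.\<close>

definition ext_deriv ::
  "('a, 'n::finite) tensor3 \<Rightarrow> ('a, 'n) chart \<Rightarrow> real^'n \<Rightarrow> real^'n \<Rightarrow> real^'n \<Rightarrow> real^'n \<Rightarrow> real^'n \<Rightarrow> real" where
  "ext_deriv \<omega> c x t u v w =
     D (\<lambda>y. \<omega> c y u v w) x t - D (\<lambda>y. \<omega> c y t v w) x u
     + D (\<lambda>y. \<omega> c y t u w) x v - D (\<lambda>y. \<omega> c y t u v) x w"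

definition closed_3form :: "('a, 'n::finite) chart set \<Rightarrow> ('a, 'n) tensor3 \<Rightarrow> bool" where
  "closed_3form A \<omega> \<longleftrightarrow> (\<forall>c\<in>A. \<forall>x\<in>img c. \<forall>t u v w. ext_deriv \<omega> c x t u v w = 0)"

section \<open>Connections and curvature\<close>

text \<open>An affine connection is given by its Christoffel maps: in the chart \<open>c\<close> the covariant
  derivative is \<open>\<nabla>\<^sub>u Y = D Y x u + \<Gamma> c x u (Y x)\<close>. The last clause says that this derivative is
  independent of the chart.\<close>

type_synonym ('a, 'n) conn = "('a, 'n) chart \<Rightarrow> real^'n \<Rightarrow> real^'n \<Rightarrow> real^'n \<Rightarrow> real^'n"

definition affine_connection :: "('a, 'n::finite) chart set \<Rightarrow> ('a, 'n) conn \<Rightarrow> bool" where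
  "affine_connection A \<Gamma> \<longleftrightarrow>
     (\<forall>c\<in>A. \<forall>x\<in>img c. bilinear (\<Gamma> c x)) \<and>
     (\<forall>c\<in>A. \<forall>u v. smooth_on (img c) (\<lambda>x. \<Gamma> c x u v)) \<and>
     (\<forall>c\<in>A. \<forall>d\<in>A. \<forall>x\<in>overlap c d. \<forall>u v.
        D (transition c d) x (\<Gamma> c x u v) =
          D (\<lambda>y. D (transition c d) y v) x u
          + \<Gamma> d (transition c d x) (D (transition c d) x u) (D (transition c d) x v))"

definition cov_deriv ::
  "(real^'n \<Rightarrow> real^'n \<Rightarrow> real^'n \<Rightarrow> real^'n) \<Rightarrow>
   (real^'n::finite \<Rightarrow> real^'n) \<Rightarrow> (real^'n \<Rightarrow> real^'n) \<Rightarrow> real^'n \<Rightarrow> real^'n" where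
  "cov_deriv \<Gamma>c X Y x = D Y x (X x) + \<Gamma>c x (X x) (Y x)"

definition lie_bracket ::
  "(real^'n::finite \<Rightarrow> real^'n) \<Rightarrow> (real^'n \<Rightarrow> real^'n) \<Rightarrow> real^'n \<Rightarrow> real^'n" where
  "lie_bracket X Y x = D Y x (X x) - D X x (Y x)"

text \<open>\<open>\<nabla>g = 0\<close> and \<open>\<nabla>\<^sub>X Y - \<nabla>\<^sub>Y X = [X, Y]\<close>, on constant coordinate vector fields.\<close>

definition levi_civita ::
  "('a, 'n::finite) chart set \<Rightarrow> ('a, 'n) tensor2 \<Rightarrow> ('a, 'n) conn \<Rightarrow> bool" where
  "levi_civita A g \<Gamma> \<longleftrightarrow> affine_connection A \<Gamma> \<and>
     (\<forall>c\<in>A. \<forall>x\<in>img c. \<forall>u v w.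
        D (\<lambda>y. g c y v w) x u = g c x (\<Gamma> c x u v) w + g c x v (\<Gamma> c x u w)) \<and>
     (\<forall>c\<in>A. \<forall>x\<in>img c. \<forall>u v. \<Gamma> c x u v = \<Gamma> c x v u)"

definition curvature ::
  "(real^'n \<Rightarrow> real^'n \<Rightarrow> real^'n \<Rightarrow> real^'n) \<Rightarrow> (real^'n::finite \<Rightarrow> real^'n) \<Rightarrow>
   (real^'n \<Rightarrow> real^'n) \<Rightarrow> (real^'n \<Rightarrow> real^'n) \<Rightarrow> real^'n \<Rightarrow> real^'n" where
  "curvature \<Gamma>c X Y Z x =
     cov_deriv \<Gamma>c X (cov_deriv \<Gamma>c Y Z) x - cov_deriv \<Gamma>c Y (cov_deriv \<Gamma>c X Z) x
     - cov_deriv \<Gamma>c (lie_bracket X Y) Z x"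

definition orthonormal_frame_on ::
  "('a, 'n::finite) tensor2 \<Rightarrow> ('a, 'n) chart \<Rightarrow> (real^'n) set \<Rightarrow> ('n \<Rightarrow> real^'n \<Rightarrow> real^'n) \<Rightarrow> bool" where
  "orthonormal_frame_on g c V e \<longleftrightarrow> open V \<and> V \<subseteq> img c \<and> (\<forall>i. smooth_on V (e i)) \<and>
     (\<forall>x\<in>V. \<forall>i j. g c x (e i x) (e j x) = (if i = j then 1 else 0))"

definition riem ::
  "('a, 'n::finite) tensor2 \<Rightarrow> ('a, 'n) conn \<Rightarrow> ('a, 'n) chart \<Rightarrow> ('n \<Rightarrow> real^'n \<Rightarrow> real^'n) \<Rightarrow>
   real^'n \<Rightarrow> 'n \<Rightarrow> 'n \<Rightarrow> 'n \<Rightarrow> 'n \<Rightarrow> real" where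
  "riem g \<Gamma> c e x s i j k = g c x (curvature (\<Gamma> c) (e s) (e i) (e j) x) (e k x)"

definition ricci ::
  "('a, 'n::finite) tensor2 \<Rightarrow> ('a, 'n) conn \<Rightarrow> ('a, 'n) chart \<Rightarrow> ('n \<Rightarrow> real^'n \<Rightarrow> real^'n) \<Rightarrow>
   real^'n \<Rightarrow> 'n \<Rightarrow> 'n \<Rightarrow> real" where
  "ricci g \<Gamma> c e x i j = (\<Sum>s\<in>UNIV. riem g \<Gamma> c e x s i j s)"

definition scalar_curv ::
  "('a, 'n::finite) tensor2 \<Rightarrow> ('a, 'n) conn \<Rightarrow> ('a, 'n) chart \<Rightarrow> ('n \<Rightarrow> real^'n \<Rightarrow> real^'n) \<Rightarrow>
   real^'n \<Rightarrow> real" where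
  "scalar_curv g \<Gamma> c e x = (\<Sum>i\<in>UNIV. ricci g \<Gamma> c e x i i)"

text \<open>Tensor equations are required in every local orthonormal frame.\<close>

definition einstein ::
  "('a, 'n::finite) chart set \<Rightarrow> ('a, 'n) tensor2 \<Rightarrow> ('a, 'n) conn \<Rightarrow> bool" where
  "einstein A g \<Gamma> \<longleftrightarrow>
     (\<forall>c\<in>A. \<forall>V e. orthonormal_frame_on g c V e \<longrightarrow> (\<forall>x\<in>V. \<forall>i j.
        ricci g \<Gamma> c e x i j
          - scalar_curv g \<Gamma> c e x / real CARD('n) * g c x (e i x) (e j x) = 0))"

section \<open>\<open>G\<^sub>2\<close>-structures\<close>

text \<open>Indices run over the type \<open>7\<close>, whose elements are the residues modulo 7; in particular the
  index written \<open>7\<close> is the element \<open>0\<close>.\<close>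

definition wedge3 :: "real^7 \<Rightarrow> real^7 \<Rightarrow> real^7 \<Rightarrow> real^7 \<Rightarrow> real^7 \<Rightarrow> real^7 \<Rightarrow> real" where
  "wedge3 \<alpha> \<beta> \<gamma> u v w =
     det (vector [vector [\<alpha> \<bullet> u, \<alpha> \<bullet> v, \<alpha> \<bullet> w],
                  vector [\<beta> \<bullet> u, \<beta> \<bullet> v, \<beta> \<bullet> w],
                  vector [\<gamma> \<bullet> u, \<gamma> \<bullet> v, \<gamma> \<bullet> w]] :: real^3^3)"

definition G2_form :: "(7 \<Rightarrow> real^7) \<Rightarrow> real^7 \<Rightarrow> real^7 \<Rightarrow> real^7 \<Rightarrow> real" where
  "G2_form \<theta> u v w =
     wedge3 (\<theta> 1) (\<theta> 2) (\<theta> 4) u v w + wedge3 (\<theta> 2) (\<theta> 3) (\<theta> 5) u v w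
   + wedge3 (\<theta> 3) (\<theta> 4) (\<theta> 6) u v w + wedge3 (\<theta> 4) (\<theta> 5) (\<theta> 7) u v w
   + wedge3 (\<theta> 5) (\<theta> 6) (\<theta> 1) u v w + wedge3 (\<theta> 6) (\<theta> 7) (\<theta> 2) u v w
   + wedge3 (\<theta> 7) (\<theta> 1) (\<theta> 3) u v w"

text \<open>Covectors are represented by vectors of coordinate components, acting by \<open>v \<mapsto> \<theta> i x \<bullet> v\<close>.\<close>

definition adapted_coframe_on ::
  "('a, 7) tensor3 \<Rightarrow> ('a, 7) chart \<Rightarrow> (real^7) set \<Rightarrow> (7 \<Rightarrow> real^7 \<Rightarrow> real^7) \<Rightarrow> bool" where
  "adapted_coframe_on \<omega> c V \<theta> \<longleftrightarrow> open V \<and> V \<subseteq> img c \<and> (\<forall>i. smooth_on V (\<theta> i)) \<and>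
     (\<forall>x\<in>V. inj (\<lambda>i. \<theta> i x) \<and> independent (range (\<lambda>i. \<theta> i x)) \<and>
        (\<forall>u v w. \<omega> c x u v w = G2_form (\<lambda>i. \<theta> i x) u v w))"

definition G2_structure :: "('a, 7) chart set \<Rightarrow> ('a, 7) tensor3 \<Rightarrow> bool" where
  "G2_structure A \<omega> \<longleftrightarrow> differential_3form A \<omega> \<and>
     (\<forall>c\<in>A. \<forall>x\<in>img c. \<exists>V \<theta>. x \<in> V \<and> adapted_coframe_on \<omega> c V \<theta>)"

text \<open>The metric for which adapted coframes are orthonormal. One adapted coframe around every
  point is enough, as any two of them differ by an element of \<open>G\<^sub>2 \<subseteq> SO(7)\<close>.\<close>

definition induced_metric ::
  "('a, 7) chart set \<Rightarrow> ('a, 7) tensor3 \<Rightarrow> ('a, 7) tensor2 \<Rightarrow> bool" where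
  "induced_metric A \<omega> g \<longleftrightarrow> riemannian_metric A g \<and>
     (\<forall>c\<in>A. \<forall>x\<in>img c. \<exists>V \<theta>. x \<in> V \<and> adapted_coframe_on \<omega> c V \<theta> \<and>
        (\<forall>y\<in>V. \<forall>u v. g c y u v = (\<Sum>i\<in>UNIV. (\<theta> i y \<bullet> u) * (\<theta> i y \<bullet> v))))"

definition star_ricci ::
  "('a, 7) tensor3 \<Rightarrow> ('a, 7) tensor2 \<Rightarrow> ('a, 7) conn \<Rightarrow> ('a, 7) chart \<Rightarrow>
   (7 \<Rightarrow> real^7 \<Rightarrow> real^7) \<Rightarrow> real^7 \<Rightarrow> 7 \<Rightarrow> 7 \<Rightarrow> real" where
  "star_ricci \<omega> g \<Gamma> c e x s m =
     (\<Sum>i\<in>UNIV. \<Sum>j\<in>UNIV. \<Sum>k\<in>UNIV. \<Sum>l\<in>UNIV. riem g \<Gamma> c e x i j k l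
        * \<omega> c x (e i x) (e j x) (e s x) * \<omega> c x (e k x) (e l x) (e m x))"

definition star_scalar_curv ::
  "('a, 7) tensor3 \<Rightarrow> ('a, 7) tensor2 \<Rightarrow> ('a, 7) conn \<Rightarrow> ('a, 7) chart \<Rightarrow>
   (7 \<Rightarrow> real^7 \<Rightarrow> real^7) \<Rightarrow> real^7 \<Rightarrow> real" where
  "star_scalar_curv \<omega> g \<Gamma> c e x = (\<Sum>i\<in>UNIV. star_ricci \<omega> g \<Gamma> c e x i i)"

definition star_einstein ::
  "('a, 7) chart set \<Rightarrow> ('a, 7) tensor3 \<Rightarrow> ('a, 7) tensor2 \<Rightarrow> ('a, 7) conn \<Rightarrow> bool" where
  "star_einstein A \<omega> g \<Gamma> \<longleftrightarrow>
     (\<forall>c\<in>A. \<forall>V e. orthonormal_frame_on g c V e \<longrightarrow> (\<forall>x\<in>V. \<forall>s m.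
        star_ricci \<omega> g \<Gamma> c e x s m
          = star_scalar_curv \<omega> g \<Gamma> c e x / 7 * g c x (e s x) (e m x)))"

definition cov_deriv_3form ::
  "('a, 'n) conn \<Rightarrow> ('a, 'n::finite) tensor3 \<Rightarrow> ('a, 'n) chart \<Rightarrow>
   real^'n \<Rightarrow> real^'n \<Rightarrow> real^'n \<Rightarrow> real^'n \<Rightarrow> real^'n \<Rightarrow> real" where
  "cov_deriv_3form \<Gamma> \<omega> c x t u v w =
     D (\<lambda>y. \<omega> c y u v w) x t
     - \<omega> c x (\<Gamma> c x t u) v w - \<omega> c x u (\<Gamma> c x t v) w - \<omega> c x u v (\<Gamma> c x t w)"

definition parallel_3form ::
  "('a, 'n::finite) chart set \<Rightarrow> ('a, 'n) conn \<Rightarrow> ('a, 'n) tensor3 \<Rightarrow> bool" where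
  "parallel_3form A \<Gamma> \<omega> \<longleftrightarrow> (\<forall>c\<in>A. \<forall>x\<in>img c. \<forall>t u v w. cov_deriv_3form \<Gamma> \<omega> c x t u v w = 0)"

end

theory Submission
  imports Defs
begin

text \<open>Fix a frame dual to an adapted coframe. The components of the fundamental form are then
  constants \<open>\<phi>\<^sub>i\<^sub>j\<^sub>k\<close>, and its covariant derivative is determined by the torsion
  \<open>P\<^sub>i\<^sub>l = \<Gamma>\<^sub>i\<^sub>a\<^sub>b \<phi>\<^sub>a\<^sub>b\<^sub>l\<close>. If the form is closed, each \<open>P\<close> is a matrix in the Lie algebra of
  \<open>G\<^sub>2\<close>. Contracting \<open>R\<^sub>s\<^sub>i\<^sub>a\<^sub>b \<phi>\<^sub>a\<^sub>b\<^sub>l\<close>, which is the exterior covariant derivative of \<open>P\<close> plus a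
  quadratic term, with \<open>\<phi>\<close> in two ways gives
  \<open>2 \<rho> = C - P\<^sup>2/2\<close> (by the first Bianchi identity) and \<open>\<rho>\<^sup>\<star> = - 2 C - 2 P\<^sup>2 + tr(P\<^sup>2)/2\<close> with the
  same curl \<open>C\<close> of \<open>P\<close>, up to transposition. Eliminating \<open>C\<close>, \<open>3 P\<^sup>2 = - 4 \<rho> - \<rho>\<^sup>\<star> + tr(P\<^sup>2)/2\<close>. So both
  Einstein conditions make \<open>P\<^sup>2\<close> a multiple of the identity. A skew matrix of odd size is singular,
  hence \<open>P\<^sup>2 = 0\<close> and \<open>P = 0\<close>.\<close>

section \<open>The three-form on seven-dimensional space\<close>

lemma exhaust_7:
  fixes x :: 7
  shows "x = 0 \<or> x = 1 \<or> x = 2 \<or> x = 3 \<or> x = 4 \<or> x = 5 \<or> x = 6"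
proof (induct x)
  case (of_int z)
  then have "z = 0 \<or> z = 1 \<or> z = 2 \<or> z = 3 \<or> z = 4 \<or> z = 5 \<or> z = 6" by auto
  then show ?case by auto
qed

lemma UNIV_7: "(UNIV :: 7 set) = {0,1,2,3,4,5,6}"
  using exhaust_7 by auto

lemma all_7: "(\<forall>i::7. P i) \<longleftrightarrow> P 0 \<and> P 1 \<and> P 2 \<and> P 3 \<and> P 4 \<and> P 5 \<and> P 6"
  by (metis exhaust_7)

lemma sum_7: "sum f (UNIV :: 7 set) = f 0 + f 1 + f 2 + f 3 + f 4 + f 5 + f 6"
  for f :: "7 \<Rightarrow> 'a::comm_monoid_add"
  unfolding UNIV_7 by (simp add: ac_simps)

definition perm3 :: "7 \<Rightarrow> 7 \<Rightarrow> 7 \<Rightarrow> 7 \<Rightarrow> 7 \<Rightarrow> 7 \<Rightarrow> real" where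
  "perm3 a b c i j k =
     of_bool (i = a \<and> j = b \<and> k = c) + of_bool (i = b \<and> j = c \<and> k = a) + of_bool (i = c \<and> j = a \<and> k = b)
   - of_bool (i = b \<and> j = a \<and> k = c) - of_bool (i = a \<and> j = c \<and> k = b) - of_bool (i = c \<and> j = b \<and> k = a)"

text \<open>The triples are the translates of \<open>1 2 4\<close> modulo 7, that is, the lines of a
  Fano plane with a cyclic orientation; the index 7 appears as \<open>0\<close>.\<close>

definition fano :: "7 \<Rightarrow> 7 \<Rightarrow> 7 \<Rightarrow> real" where
  "fano i j k = perm3 1 2 4 i j k + perm3 2 3 5 i j k + perm3 3 4 6 i j k + perm3 4 5 0 i j k
     + perm3 5 6 1 i j k + perm3 6 0 2 i j k + perm3 0 1 3 i j k"

lemma neq_7: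
  "(0::7) \<noteq> 1" "(0::7) \<noteq> 2" "(0::7) \<noteq> 3" "(0::7) \<noteq> 4"
  "(0::7) \<noteq> 5" "(0::7) \<noteq> 6" "(1::7) \<noteq> 0" "(1::7) \<noteq> 2"
  "(1::7) \<noteq> 3" "(1::7) \<noteq> 4" "(1::7) \<noteq> 5" "(1::7) \<noteq> 6"
  "(2::7) \<noteq> 0" "(2::7) \<noteq> 1" "(2::7) \<noteq> 3" "(2::7) \<noteq> 4"
  "(2::7) \<noteq> 5" "(2::7) \<noteq> 6" "(3::7) \<noteq> 0" "(3::7) \<noteq> 1"
  "(3::7) \<noteq> 2" "(3::7) \<noteq> 4" "(3::7) \<noteq> 5" "(3::7) \<noteq> 6"
  "(4::7) \<noteq> 0" "(4::7) \<noteq> 1" "(4::7) \<noteq> 2" "(4::7) \<noteq> 3"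
  "(4::7) \<noteq> 5" "(4::7) \<noteq> 6" "(5::7) \<noteq> 0" "(5::7) \<noteq> 1"
  "(5::7) \<noteq> 2" "(5::7) \<noteq> 3" "(5::7) \<noteq> 4" "(5::7) \<noteq> 6"
  "(6::7) \<noteq> 0" "(6::7) \<noteq> 1" "(6::7) \<noteq> 2" "(6::7) \<noteq> 3"
  "(6::7) \<noteq> 4" "(6::7) \<noteq> 5"
  by simp_all

text \<open>Two distinct points lie on a single line, so the first two indices determine the third.
  The third stays a variable so that sums over it collapse to one term.\<close>

lemma fano_table:
  "fano 0 0 k = 0"
  "fano 0 1 k = of_bool (k = 3)"
  "fano 0 2 k = of_bool (k = 6)"
  "fano 0 3 k = - of_bool (k = 1)"
  "fano 0 4 k = of_bool (k = 5)"
  "fano 0 5 k = - of_bool (k = 4)"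
  "fano 0 6 k = - of_bool (k = 2)"
  "fano 1 0 k = - of_bool (k = 3)"
  "fano 1 1 k = 0"
  "fano 1 2 k = of_bool (k = 4)"
  "fano 1 3 k = of_bool (k = 0)"
  "fano 1 4 k = - of_bool (k = 2)"
  "fano 1 5 k = of_bool (k = 6)"
  "fano 1 6 k = - of_bool (k = 5)"
  "fano 2 0 k = - of_bool (k = 6)"
  "fano 2 1 k = - of_bool (k = 4)"
  "fano 2 2 k = 0"
  "fano 2 3 k = of_bool (k = 5)"
  "fano 2 4 k = of_bool (k = 1)"
  "fano 2 5 k = - of_bool (k = 3)"
  "fano 2 6 k = of_bool (k = 0)"
  "fano 3 0 k = of_bool (k = 1)"
  "fano 3 1 k = - of_bool (k = 0)"
  "fano 3 2 k = - of_bool (k = 5)"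
  "fano 3 3 k = 0"
  "fano 3 4 k = of_bool (k = 6)"
  "fano 3 5 k = of_bool (k = 2)"
  "fano 3 6 k = - of_bool (k = 4)"
  "fano 4 0 k = - of_bool (k = 5)"
  "fano 4 1 k = of_bool (k = 2)"
  "fano 4 2 k = - of_bool (k = 1)"
  "fano 4 3 k = - of_bool (k = 6)"
  "fano 4 4 k = 0"
  "fano 4 5 k = of_bool (k = 0)"
  "fano 4 6 k = of_bool (k = 3)"
  "fano 5 0 k = of_bool (k = 4)"
  "fano 5 1 k = - of_bool (k = 6)"
  "fano 5 2 k = of_bool (k = 3)"
  "fano 5 3 k = - of_bool (k = 2)"
  "fano 5 4 k = - of_bool (k = 0)"
  "fano 5 5 k = 0"
  "fano 5 6 k = of_bool (k = 1)"
  "fano 6 0 k = of_bool (k = 2)"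
  "fano 6 1 k = of_bool (k = 5)"
  "fano 6 2 k = - of_bool (k = 0)"
  "fano 6 3 k = of_bool (k = 4)"
  "fano 6 4 k = - of_bool (k = 3)"
  "fano 6 5 k = - of_bool (k = 1)"
  "fano 6 6 k = 0"
  by (simp_all add: fano_def perm3_def neq_7)

text \<open>The \<open>G\<^sub>2\<close>-equivariant projection \<open>so(7) \<rightarrow> \<real>\<^sup>7\<close>, up to scale; its kernel is the Lie algebra of \<open>G\<^sub>2\<close>.\<close>

definition vec_part :: "(7 \<Rightarrow> 7 \<Rightarrow> real) \<Rightarrow> 7 \<Rightarrow> real" where
  "vec_part G l = (\<Sum>a\<in>UNIV. \<Sum>b\<in>UNIV. G a b * fano a b l)"

section \<open>The projection of skew matrices to seven-dimensional vectors\<close>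

text \<open>Oriented as rewrite rules: every entry is reduced to the 21 above the diagonal, after
  which identities become polynomial ones in free variables.\<close>

lemma skew_7:
  fixes G :: "7 \<Rightarrow> 7 \<Rightarrow> real"
  assumes "\<And>i j. G i j = - G j i"
  shows "G 0 0 = 0" "G 1 1 = 0" "G 2 2 = 0" "G 3 3 = 0" "G 4 4 = 0" "G 5 5 = 0" "G 6 6 = 0"
   "G 1 0 = - G 0 1" "G 2 0 = - G 0 2" "G 2 1 = - G 1 2" "G 3 0 = - G 0 3" "G 3 1 = - G 1 3"
   "G 3 2 = - G 2 3" "G 4 0 = - G 0 4" "G 4 1 = - G 1 4" "G 4 2 = - G 2 4" "G 4 3 = - G 3 4"
   "G 5 0 = - G 0 5" "G 5 1 = - G 1 5" "G 5 2 = - G 2 5" "G 5 3 = - G 3 5" "G 5 4 = - G 4 5"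
   "G 6 0 = - G 0 6" "G 6 1 = - G 1 6" "G 6 2 = - G 2 6" "G 6 3 = - G 3 6" "G 6 4 = - G 4 6"
   "G 6 5 = - G 5 6"
  by (metis assms equal_neg_zero)+

text \<open>Three lines pass through each point, hence three antisymmetric pairs per
  component.\<close>

lemma sum_fano:
  fixes h :: "7 \<Rightarrow> 7 \<Rightarrow> real"
  shows "(\<Sum>a\<in>UNIV. \<Sum>b\<in>UNIV. h a b * fano a b 0) = (h 1 3 - h 3 1) + (h 2 6 - h 6 2) + (h 4 5 - h 5 4)"
    "(\<Sum>a\<in>UNIV. \<Sum>b\<in>UNIV. h a b * fano a b 1) = (h 2 4 - h 4 2) + (h 3 0 - h 0 3) + (h 5 6 - h 6 5)"
    "(\<Sum>a\<in>UNIV. \<Sum>b\<in>UNIV. h a b * fano a b 2) = (h 3 5 - h 5 3) + (h 4 1 - h 1 4) + (h 6 0 - h 0 6)"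
    "(\<Sum>a\<in>UNIV. \<Sum>b\<in>UNIV. h a b * fano a b 3) = (h 4 6 - h 6 4) + (h 5 2 - h 2 5) + (h 0 1 - h 1 0)"
    "(\<Sum>a\<in>UNIV. \<Sum>b\<in>UNIV. h a b * fano a b 4) = (h 5 0 - h 0 5) + (h 6 3 - h 3 6) + (h 1 2 - h 2 1)"
    "(\<Sum>a\<in>UNIV. \<Sum>b\<in>UNIV. h a b * fano a b 5) = (h 6 1 - h 1 6) + (h 0 4 - h 4 0) + (h 2 3 - h 3 2)"
    "(\<Sum>a\<in>UNIV. \<Sum>b\<in>UNIV. h a b * fano a b 6) = (h 0 2 - h 2 0) + (h 1 5 - h 5 1) + (h 3 4 - h 4 3)"
  by (simp_all add: sum_7 fano_table neq_7)

lemma vec_part_eval: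
  assumes "\<And>i j. G i j = - G j i"
  shows "vec_part G 0 = 2 * (G 1 3 + G 2 6 + G 4 5)"
    "vec_part G 1 = 2 * (G 2 4 + - G 0 3 + G 5 6)"
    "vec_part G 2 = 2 * (G 3 5 + - G 1 4 + - G 0 6)"
    "vec_part G 3 = 2 * (G 4 6 + - G 2 5 + G 0 1)"
    "vec_part G 4 = 2 * (- G 0 5 + - G 3 6 + G 1 2)"
    "vec_part G 5 = 2 * (- G 1 6 + G 0 4 + G 2 3)"
    "vec_part G 6 = 2 * (G 0 2 + G 1 5 + G 3 4)"
  by (simp_all only: vec_part_def sum_fano skew_7[of G, OF assms]) simp_all

text \<open>For \<open>G\<close> in the kernel of \<open>vec_part\<close> this is equivariance of
  the projection. The last sum, the cross product of the two vector parts, is the correction for the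
  complement. The proof expands both sides in the entries above the diagonals.\<close>

lemma vec_part_commutator:
  assumes G: "\<And>i j. G i j = - G j i" and H: "\<And>i j. H i j = - H j i"
  shows "2 * vec_part (\<lambda>i j. \<Sum>c\<in>UNIV. G i c * H c j - H i c * G c j) l
    = 2 * (\<Sum>c\<in>UNIV. G l c * vec_part H c - H l c * vec_part G c)
      + (\<Sum>a\<in>UNIV. \<Sum>b\<in>UNIV. vec_part G a * vec_part H b * fano a b l)"
  unfolding vec_part_def[of "\<lambda>i j. \<Sum>c\<in>UNIV. _ i j c"]
  using exhaust_7[of l]
  by (elim disjE; simp only: sum_fano;
      simp only: sum_7 vec_part_eval[of G, OF G] vec_part_eval[of H, OF H];
      simp only: skew_7[of G, OF G] skew_7[of H, OF H]; simp add: algebra_simps)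

lemma perm3_skew: "perm3 a b c j i k = - perm3 a b c i j k" "perm3 a b c i k j = - perm3 a b c i j k"
  by (simp_all add: perm3_def conj_ac)

lemma fano_skew: "fano j i k = - fano i j k" "fano i k j = - fano i j k"
  unfolding fano_def
  by (simp add: perm3_skew(1)[of _ _ _ j i k], simp add: perm3_skew(2)[of _ _ _ i k j])

lemma vec_part_add: "vec_part (\<lambda>i j. G i j + H i j) l = vec_part G l + vec_part H l"
  and vec_part_diff: "vec_part (\<lambda>i j. G i j - H i j) l = vec_part G l - vec_part H l"
  and vec_part_minus: "vec_part (\<lambda>i j. - G i j) l = - vec_part G l"
  and vec_part_cmult: "vec_part (\<lambda>i j. r * G i j) l = r * vec_part G l"
  by (simp_all add: vec_part_def algebra_simps sum.distrib sum_subtractf sum_negf sum_distrib_left)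

lemma vec_part_sum: "vec_part (\<lambda>i j. \<Sum>c\<in>S. G c i j) l = (\<Sum>c\<in>S. vec_part (G c) l)"
  by (induction S rule: infinite_finite_induct) (simp_all add: vec_part_add vec_part_cmult[of 0, simplified])

lemma vec_part_transpose: "vec_part (\<lambda>i j. G j i) l = - vec_part G l"
proof -
  have "vec_part (\<lambda>i j. G j i) l = (\<Sum>a\<in>UNIV. \<Sum>b\<in>UNIV. G a b * fano b a l)"
    unfolding vec_part_def by (rule sum.swap)
  also have "\<dots> = - vec_part G l"
    unfolding vec_part_def sum_negf[symmetric] by (intro sum.cong refl) (metis fano_skew(1) mult_minus_right)
  finally show ?thesis .
qed

text \<open>The infinitesimal action of a matrix on the three-form \<open>fano\<close>.\<close>

definition fano_der :: "(7 \<Rightarrow> 7 \<Rightarrow> real) \<Rightarrow> 7 \<Rightarrow> 7 \<Rightarrow> 7 \<Rightarrow> real" where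
  "fano_der G i j k = (\<Sum>a\<in>UNIV. G i a * fano a j k + G j a * fano i a k + G k a * fano i j a)"

section \<open>The action of skew matrices on the three-form and its kernel\<close>

lemma fano_der_skew: "fano_der G j i k = - fano_der G i j k" "fano_der G i k j = - fano_der G i j k"
proof -
  show "fano_der G j i k = - fano_der G i j k"
    unfolding fano_der_def sum_negf[symmetric]
  proof (intro sum.cong refl)
    fix a
    show "G j a * fano a i k + G i a * fano j a k + G k a * fano j i a =
       - (G i a * fano a j k + G j a * fano i a k + G k a * fano i j a)"
      using fano_skew(1)[of a i k] fano_skew(1)[of j a k] fano_skew(1)[of j i a] by simp
  qed
  show "fano_der G i k j = - fano_der G i j k"
    unfolding fano_der_def sum_negf[symmetric]
  proof (intro sum.cong refl)
    fix a
    show "G i a * fano a k j + G k a * fano i a j + G j a * fano i k a =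
       - (G i a * fano a j k + G j a * fano i a k + G k a * fano i j a)"
      using fano_skew(2)[of a k j] fano_skew(2)[of i a j] fano_skew(2)[of i k a] by simp
  qed
qed

text \<open>Up to a constant this is the vector part inserted into the dual four-form: lines give
  zero, and any other triple is completed by exactly one index to the complement of a line. So a
  skew matrix acts on the form only through its vector part.\<close>

lemma fano_der_eval:
  assumes "\<And>i j. G i j = - G j i"
  shows "fano_der G 0 1 2 = vec_part G 5 / 2"
    "fano_der G 0 1 3 = 0"
    "fano_der G 0 1 4 = - vec_part G 6 / 2"
    "fano_der G 0 1 5 = - vec_part G 2 / 2"
    "fano_der G 0 1 6 = vec_part G 4 / 2"
    "fano_der G 0 2 3 = - vec_part G 4 / 2"
    "fano_der G 0 2 4 = vec_part G 3 / 2"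
    "fano_der G 0 2 5 = vec_part G 1 / 2"
    "fano_der G 0 2 6 = 0"
    "fano_der G 0 3 4 = - vec_part G 2 / 2"
    "fano_der G 0 3 5 = vec_part G 6 / 2"
    "fano_der G 0 3 6 = - vec_part G 5 / 2"
    "fano_der G 0 4 5 = 0"
    "fano_der G 0 4 6 = - vec_part G 1 / 2"
    "fano_der G 0 5 6 = vec_part G 3 / 2"
    "fano_der G 1 2 3 = vec_part G 6 / 2"
    "fano_der G 1 2 4 = 0"
    "fano_der G 1 2 5 = - vec_part G 0 / 2"
    "fano_der G 1 2 6 = - vec_part G 3 / 2"
    "fano_der G 1 3 4 = - vec_part G 5 / 2"
    "fano_der G 1 3 5 = vec_part G 4 / 2"
    "fano_der G 1 3 6 = vec_part G 2 / 2"
    "fano_der G 1 4 5 = - vec_part G 3 / 2"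
    "fano_der G 1 4 6 = vec_part G 0 / 2"
    "fano_der G 1 5 6 = 0"
    "fano_der G 2 3 4 = vec_part G 0 / 2"
    "fano_der G 2 3 5 = 0"
    "fano_der G 2 3 6 = - vec_part G 1 / 2"
    "fano_der G 2 4 5 = - vec_part G 6 / 2"
    "fano_der G 2 4 6 = vec_part G 5 / 2"
    "fano_der G 2 5 6 = - vec_part G 4 / 2"
    "fano_der G 3 4 5 = vec_part G 1 / 2"
    "fano_der G 3 4 6 = 0"
    "fano_der G 3 5 6 = - vec_part G 0 / 2"
    "fano_der G 4 5 6 = vec_part G 2 / 2"
  unfolding fano_der_def vec_part_eval[of G, OF assms]
  by (simp_all only: sum_7 fano_table neq_7 of_bool_eq simp_thms, simp_all add: skew_7[of G, OF assms])

text \<open>The seven equations involve disjoint sets of entries, so each can be solved for one of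
  them. The 14 entries that remain are coordinates on the Lie algebra of G2.\<close>

lemma g2_eval:
  assumes "\<And>i j. G i j = - G j i" "\<And>l. vec_part G l = 0"
  shows "G 4 5 = - G 1 3 + (- G 2 6)"
    "G 5 6 = - G 2 4 + (G 0 3)"
    "G 0 6 = G 3 5 + (- G 1 4)"
    "G 0 1 = - G 4 6 + (G 2 5)"
    "G 1 2 = G 0 5 + (G 3 6)"
    "G 2 3 = G 1 6 + (- G 0 4)"
    "G 3 4 = - G 0 2 + (- G 1 5)"
  using assms(2)[of 0] assms(2)[of 1] assms(2)[of 2] assms(2)[of 3] assms(2)[of 4] assms(2)[of 5] assms(2)[of 6]
  unfolding vec_part_eval[of G, OF assms(1)] by simp_all

text \<open>For each of the 35 increasing triples the cyclic identity eliminates the entry whose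
  first index is largest. Spelling out the instances keeps the rewriting directed.\<close>

lemma bianchi_eval:
  fixes W :: "7 \<Rightarrow> 7 \<Rightarrow> 7 \<Rightarrow> real"
  assumes "\<And>s a b. W s a b = - W s b a" "\<And>s a b. W s a b + W a b s + W b s a = 0"
  shows "W 2 0 1 = W 1 0 2 - W 0 1 2" "W 3 0 1 = W 1 0 3 - W 0 1 3" "W 4 0 1 = W 1 0 4 - W 0 1 4"
    "W 5 0 1 = W 1 0 5 - W 0 1 5" "W 6 0 1 = W 1 0 6 - W 0 1 6" "W 3 0 2 = W 2 0 3 - W 0 2 3"
    "W 4 0 2 = W 2 0 4 - W 0 2 4" "W 5 0 2 = W 2 0 5 - W 0 2 5" "W 6 0 2 = W 2 0 6 - W 0 2 6"
    "W 4 0 3 = W 3 0 4 - W 0 3 4" "W 5 0 3 = W 3 0 5 - W 0 3 5" "W 6 0 3 = W 3 0 6 - W 0 3 6"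
    "W 5 0 4 = W 4 0 5 - W 0 4 5" "W 6 0 4 = W 4 0 6 - W 0 4 6" "W 6 0 5 = W 5 0 6 - W 0 5 6"
    "W 3 1 2 = W 2 1 3 - W 1 2 3" "W 4 1 2 = W 2 1 4 - W 1 2 4" "W 5 1 2 = W 2 1 5 - W 1 2 5"
    "W 6 1 2 = W 2 1 6 - W 1 2 6" "W 4 1 3 = W 3 1 4 - W 1 3 4" "W 5 1 3 = W 3 1 5 - W 1 3 5"
    "W 6 1 3 = W 3 1 6 - W 1 3 6" "W 5 1 4 = W 4 1 5 - W 1 4 5" "W 6 1 4 = W 4 1 6 - W 1 4 6"
    "W 6 1 5 = W 5 1 6 - W 1 5 6" "W 4 2 3 = W 3 2 4 - W 2 3 4" "W 5 2 3 = W 3 2 5 - W 2 3 5"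
    "W 6 2 3 = W 3 2 6 - W 2 3 6" "W 5 2 4 = W 4 2 5 - W 2 4 5" "W 6 2 4 = W 4 2 6 - W 2 4 6"
    "W 6 2 5 = W 5 2 6 - W 2 5 6" "W 5 3 4 = W 4 3 5 - W 3 4 5" "W 6 3 4 = W 4 3 6 - W 3 4 6"
    "W 6 3 5 = W 5 3 6 - W 3 5 6" "W 6 4 5 = W 5 4 6 - W 4 5 6"
proof -
  have "W c a b = W b a c - W a b c" for a b c
    using assms(1)[of b a c] assms(2)[of a b c] by simp
  note * = this
  show "W 2 0 1 = W 1 0 2 - W 0 1 2"
    "W 3 0 1 = W 1 0 3 - W 0 1 3"
    "W 4 0 1 = W 1 0 4 - W 0 1 4"
    "W 5 0 1 = W 1 0 5 - W 0 1 5"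
    "W 6 0 1 = W 1 0 6 - W 0 1 6"
    "W 3 0 2 = W 2 0 3 - W 0 2 3"
    "W 4 0 2 = W 2 0 4 - W 0 2 4"
    "W 5 0 2 = W 2 0 5 - W 0 2 5"
    "W 6 0 2 = W 2 0 6 - W 0 2 6"
    "W 4 0 3 = W 3 0 4 - W 0 3 4"
    "W 5 0 3 = W 3 0 5 - W 0 3 5"
    "W 6 0 3 = W 3 0 6 - W 0 3 6"
    "W 5 0 4 = W 4 0 5 - W 0 4 5"
    "W 6 0 4 = W 4 0 6 - W 0 4 6"
    "W 6 0 5 = W 5 0 6 - W 0 5 6"
    "W 3 1 2 = W 2 1 3 - W 1 2 3"
    "W 4 1 2 = W 2 1 4 - W 1 2 4"
    "W 5 1 2 = W 2 1 5 - W 1 2 5"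
    "W 6 1 2 = W 2 1 6 - W 1 2 6"
    "W 4 1 3 = W 3 1 4 - W 1 3 4"
    "W 5 1 3 = W 3 1 5 - W 1 3 5"
    "W 6 1 3 = W 3 1 6 - W 1 3 6"
    "W 5 1 4 = W 4 1 5 - W 1 4 5"
    "W 6 1 4 = W 4 1 6 - W 1 4 6"
    "W 6 1 5 = W 5 1 6 - W 1 5 6"
    "W 4 2 3 = W 3 2 4 - W 2 3 4"
    "W 5 2 3 = W 3 2 5 - W 2 3 5"
    "W 6 2 3 = W 3 2 6 - W 2 3 6"
    "W 5 2 4 = W 4 2 5 - W 2 4 5"
    "W 6 2 4 = W 4 2 6 - W 2 4 6"
    "W 6 2 5 = W 5 2 6 - W 2 5 6"
    "W 5 3 4 = W 4 3 5 - W 3 4 5"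
    "W 6 3 4 = W 4 3 6 - W 3 4 6"
    "W 6 3 5 = W 5 3 6 - W 3 5 6"
    "W 6 4 5 = W 5 4 6 - W 4 5 6"
    by (rule *)+
qed

text \<open>Closedness leaves only the component of the intrinsic torsion \<open>vec_part (\<Gamma> i) j\<close> that lies
  in the Lie algebra of \<open>G\<^sub>2\<close>.\<close>

lemma fano_closed_imp:
  assumes G: "\<And>s i j. \<Gamma> s i j = - \<Gamma> s j i"
    and "\<And>t i j k. fano_der (\<Gamma> t) i j k - fano_der (\<Gamma> i) t j k
     + fano_der (\<Gamma> j) t i k - fano_der (\<Gamma> k) t i j = 0"
  shows "vec_part (\<Gamma> i) j = - vec_part (\<Gamma> j) i"
    "vec_part (\<lambda>i j. vec_part (\<Gamma> i) j) l = 0"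
proof -
  define P where "P i j = vec_part (\<Gamma> i) j" for i j
  \<comment> \<open>A four-form has 35 components. Increasing indices keep every triple in the order
    in which \<open>fano_der_eval\<close> is stated.\<close>
  note ev = assms(2)[of 0 1 2 3]
   assms(2)[of 0 1 2 4]
   assms(2)[of 0 1 2 5]
   assms(2)[of 0 1 2 6]
   assms(2)[of 0 1 3 4]
   assms(2)[of 0 1 3 5]
   assms(2)[of 0 1 3 6]
   assms(2)[of 0 1 4 5]
   assms(2)[of 0 1 4 6]
   assms(2)[of 0 1 5 6]
   assms(2)[of 0 2 3 4]
   assms(2)[of 0 2 3 5]
   assms(2)[of 0 2 3 6]
   assms(2)[of 0 2 4 5]
   assms(2)[of 0 2 4 6]
   assms(2)[of 0 2 5 6]
   assms(2)[of 0 3 4 5]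
   assms(2)[of 0 3 4 6]
   assms(2)[of 0 3 5 6]
   assms(2)[of 0 4 5 6]
   assms(2)[of 1 2 3 4]
   assms(2)[of 1 2 3 5]
   assms(2)[of 1 2 3 6]
   assms(2)[of 1 2 4 5]
   assms(2)[of 1 2 4 6]
   assms(2)[of 1 2 5 6]
   assms(2)[of 1 3 4 5]
   assms(2)[of 1 3 4 6]
   assms(2)[of 1 3 5 6]
   assms(2)[of 1 4 5 6]
   assms(2)[of 2 3 4 5]
   assms(2)[of 2 3 4 6]
   assms(2)[of 2 3 5 6]
   assms(2)[of 2 4 5 6]
   assms(2)[of 3 4 5 6]
  note ev' = ev[unfolded fano_der_eval[of "\<Gamma> _", OF G], folded P_def]
  \<comment> \<open>The 35 equations are linear in the 49 entries of \<open>P\<close>; skewness is a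
    linear consequence, as is the vanishing of the vector part below.\<close>
  have skew: "P i j = - P j i" for i j
    using exhaust_7[of i] exhaust_7[of j]
    by (elim disjE; (simp only:)?) (insert ev', linarith+)
  show "vec_part (\<Gamma> i) j = - vec_part (\<Gamma> j) i"
    using skew unfolding P_def .
  have "\<forall>l. vec_part P l = 0"
    unfolding all_7 vec_part_eval[of P, OF skew] using ev' skew_7[of P, OF skew]
    by (intro conjI) argo+
  then show "vec_part (\<lambda>i j. vec_part (\<Gamma> i) j) l = 0"
    unfolding P_def by blast
qed

section \<open>Contractions of two copies of the three-form\<close>

text \<open>Contracting one index of two copies of the three-form gives two products of Kronecker
  deltas plus the dual four-form. The cyclic identity kills the four-form term, and by skewness the
  two delta terms contribute equally.\<close>

lemma ricci_contraction:
  fixes W :: "7 \<Rightarrow> 7 \<Rightarrow> 7 \<Rightarrow> real"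
  assumes skew: "\<And>s a b. W s a b = - W s b a" and cyc: "\<And>s a b. W s a b + W a b s + W b s a = 0"
  shows "vec_part (\<lambda>s l. vec_part (W s) l) k = 2 * (\<Sum>s\<in>UNIV. W s k s)"
  using exhaust_7[of k]
  by (elim disjE; simp only: vec_part_def[of "\<lambda>s l. vec_part (W s) l"] sum_fano;
      simp only: vec_part_eval[of "W _", OF skew] sum_7 skew_7[of "W _", OF skew];
      simp add: bianchi_eval[of W, OF skew cyc])

text \<open>The dual four-form acts on the Lie algebra of G2 as a scalar and contributes
  \<open>- 2 * P a k\<close>; the deltas contribute \<open>- P a k\<close>.\<close>

lemma g2_contraction:
  assumes skew: "\<And>i j. P i j = - P j i" and g2: "\<And>l. vec_part P l = 0"
  shows "vec_part (\<lambda>s l. \<Sum>b\<in>UNIV. P s b * fano a b l) k = - 3 * P a k"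
  using exhaust_7[of k] exhaust_7[of a]
  by (elim disjE; simp only: vec_part_def sum_fano;
      simp only: sum_7 fano_table neq_7 of_bool_eq simp_thms;
      simp add: skew_7[of P, OF skew] g2_eval[of P, OF skew g2])

text \<open>A matrix in the Lie algebra of G2 is a derivation of the form, so one \<open>P\<close>
  can be moved onto the other indices; contracting the two forms then leaves only the square of
  \<open>P\<close> and its trace. The proof checks this in the 14 free entries.\<close>

lemma g2_square_contraction:
  assumes skew: "\<And>i j. P i j = - P j i" and g2: "\<And>l. vec_part P l = 0"
  shows "vec_part (\<lambda>s i. \<Sum>a\<in>UNIV. \<Sum>b\<in>UNIV. (P i a * P s b) * fano a b l) m =
    - 4 * (\<Sum>c\<in>UNIV. P l c * P c m) + (if l = m then (\<Sum>a\<in>UNIV. \<Sum>c\<in>UNIV. P a c * P c a) else 0)"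
  using exhaust_7[of m] exhaust_7[of l]
  by (elim disjE; simp only: vec_part_def sum_fano neq_7 simp_thms if_True if_False;
      simp only: sum_7 skew_7[of P, OF skew];
      simp add: g2_eval[of P, OF skew g2] algebra_simps)

section \<open>The pointwise algebra of the curvature\<close>

text \<open>Increasing triples are read off from \<open>fano_der_eval\<close>; alternation gives all
  others.\<close>

lemma fano_der_g2:
  assumes skew: "\<And>i j. G i j = - G j i" and g2: "\<And>l. vec_part G l = 0"
  shows "fano_der G i j k = 0"
proof -
  note e = fano_der_eval[of G, OF skew, unfolded g2, simplified]
  have p: "fano_der G b a c = 0" "fano_der G a c b = 0" "fano_der G b c a = 0"
      "fano_der G c a b = 0" "fano_der G c b a = 0" if "fano_der G a b c = 0" for a b c
    using that fano_der_skew(1)[of G a b c] fano_der_skew(2)[of G a b c]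
      fano_der_skew(1)[of G a c b] fano_der_skew(2)[of G b a c] fano_der_skew(1)[of G b c a]
    by simp_all
  note ep = e e[THEN p(1)] e[THEN p(2)] e[THEN p(3)] e[THEN p(4)] e[THEN p(5)]
  have rep: "fano_der G a a c = 0" "fano_der G a c c = 0" "fano_der G a c a = 0" for a c
    using fano_der_skew(1)[of G a a c] fano_der_skew(2)[of G a c c]
      fano_der_skew(1)[of G a c a] fano_der_skew(2)[of G c a a] by simp_all
  show ?thesis
    using exhaust_7[of i] exhaust_7[of j] exhaust_7[of k]
    by (elim disjE; simp only: ep rep)
qed

lemma skew_square_scalar:
  fixes P :: "7 \<Rightarrow> 7 \<Rightarrow> real"
  assumes skew: "\<And>i j. P i j = - P j i"
    and sq: "\<And>l m. (\<Sum>c\<in>UNIV. P l c * P c m) = (if l = m then \<kappa> else 0)"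
  shows "P i j = 0"
proof -
  define M :: "real^7^7" where "M = (\<chi> i j. P i j)"
  have "transpose M = (-1) *\<^sub>R M"
    unfolding M_def transpose_def vec_eq_iff by (auto intro: skew)
  \<comment> \<open>The negative is written as a product so that its determinant is the seventh
    power of -1 times that of \<open>M\<close>.\<close>
  also have "\<dots> = matrix (\<lambda>v. (-1) *\<^sub>R v) ** M"
    by (simp add: vec_eq_iff matrix_def matrix_matrix_mult_def axis_def if_distrib[of "\<lambda>x. x * _"] sum_negf cong: if_cong)
  finally have "det M = (-1) ^ CARD(7) * det M"
    by (metis det_transpose det_mul det_matrix_scaleR)
  then have "det M = 0" by simp
  then have "det (M ** M) = 0" by (simp add: det_mul)
  moreover have "M ** M = matrix (\<lambda>v. \<kappa> *\<^sub>R v)"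
    by (auto simp: M_def matrix_matrix_mult_def vec_eq_iff matrix_def sq axis_def)
  ultimately have "\<kappa> = 0" by simp
  \<comment> \<open>The diagonal entries of the square of a skew matrix are minus the sums of
    squares of its rows.\<close>
  have "(\<Sum>c\<in>UNIV. P i c * P i c) = - (\<Sum>c\<in>UNIV. P i c * P c i)"
    unfolding sum_negf[symmetric] by (intro sum.cong refl) (metis skew mult_minus_right)
  also have "\<dots> = 0"
    using sq[of i i] \<open>\<kappa> = 0\<close> by simp
  finally show ?thesis by (simp add: sum_nonneg_eq_0_iff)
qed

text \<open>Four instances of the cyclic identity give the pair symmetry
  \<open>R a b c d = R c d a b\<close>, which carries the identity over from the first three indices
  to those other than the second.\<close>

lemma bianchi_last_three:
  fixes R :: "'i \<Rightarrow> 'i \<Rightarrow> 'i \<Rightarrow> 'i \<Rightarrow> real"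
  assumes skew: "\<And>a b c d. R a b c d = - R b a c d" "\<And>a b c d. R a b c d = - R a b d c"
    and bianchi: "\<And>a b c d. R a b c d + R b c a d + R c a b d = 0"
  shows "R s i a b + R a i b s + R b i s a = 0"
proof -
  have pair: "R a b c d = R c d a b" for a b c d
    using bianchi[of a b c d] bianchi[of b c d a] bianchi[of c d a b] bianchi[of d a b c]
      skew(2)[of b c a d] skew(2)[of c d a b] skew(1)[of d b c a] skew(2)[of b d c a]
      skew(2)[of d a c b] skew(1)[of a c d b] skew(2)[of c a d b] skew(2)[of a b c d]
    by linarith
  show ?thesis
    using bianchi[of s a b i] skew(1)[of s i a b] skew(2)[of i s a b]
      pair[of s i a b] pair[of a i b s] pair[of b i s a]
      skew(2)[of a b s i] skew(2)[of b s a i] skew(2)[of s a b i]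
    by linarith
qed

text \<open>Here \<open>\<Gamma> s i j\<close> stands for \<open>g(\<nabla>\<^sub>s e\<^sub>i, e\<^sub>j)\<close> and \<open>d\<Gamma> s i j k\<close> for the derivative of
  \<open>\<Gamma> i j k\<close> along \<open>e\<^sub>s\<close>, at one point.\<close>

lemma closed_einstein_star_einstein:
  fixes \<Gamma> :: "7 \<Rightarrow> 7 \<Rightarrow> 7 \<Rightarrow> real" and d\<Gamma> R :: "7 \<Rightarrow> 7 \<Rightarrow> 7 \<Rightarrow> 7 \<Rightarrow> real"
  assumes R: "\<And>s i j k. R s i j k = d\<Gamma> s i j k - d\<Gamma> i s j k
      + (\<Sum>b\<in>UNIV. \<Gamma> i j b * \<Gamma> s b k - \<Gamma> s j b * \<Gamma> i b k)
      - (\<Sum>a\<in>UNIV. (\<Gamma> s i a - \<Gamma> i s a) * \<Gamma> a j k)"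
    and skew: "\<And>s i j. \<Gamma> s i j = - \<Gamma> s j i"
    and dskew: "\<And>s i j k. d\<Gamma> s i j k = - d\<Gamma> s i k j"
    and closed: "\<And>t i j k. fano_der (\<Gamma> t) i j k - fano_der (\<Gamma> i) t j k
      + fano_der (\<Gamma> j) t i k - fano_der (\<Gamma> k) t i j = 0"
    and dclosed: "\<And>s t i j k. fano_der (d\<Gamma> s t) i j k - fano_der (d\<Gamma> s i) t j k
      + fano_der (d\<Gamma> s j) t i k - fano_der (d\<Gamma> s k) t i j = 0"
    and bianchi: "\<And>s i j k. R s i j k + R i j s k + R j s i k = 0"
    and einstein: "\<And>i j. (\<Sum>s\<in>UNIV. R s i j s) = (if i = j then \<kappa> else 0)"
    and star: "\<And>s m. (\<Sum>i\<in>UNIV. \<Sum>j\<in>UNIV. \<Sum>k\<in>UNIV. \<Sum>l\<in>UNIV.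
      R i j k l * fano i j s * fano k l m) = (if s = m then \<mu> else 0)"
  shows "fano_der (\<Gamma> t) i j k = 0"
proof -
  \<comment> \<open>\<open>P\<close> is the torsion, \<open>N\<close> its full covariant derivative and \<open>C\<close> the curl of \<open>P\<close>.\<close>
  define P where "P = (\<lambda>i l. vec_part (\<Gamma> i) l)"
  define dP where "dP = (\<lambda>s i l. vec_part (d\<Gamma> s i) l)"
  define N where "N = (\<lambda>s i l. dP s i l - (\<Sum>a\<in>UNIV. \<Gamma> s i a * P a l) - (\<Sum>c\<in>UNIV. \<Gamma> s l c * P i c))"
  define C where "C = (\<lambda>i k. vec_part (\<lambda>s l. N s i l) k)"
  define Sq where "Sq = (\<lambda>i k. \<Sum>c\<in>UNIV. P i c * P c k)"
  \<comment> \<open>The cross product of the rows \<open>P i\<close> and \<open>P s\<close>, which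
    is the quadratic term of \<open>vec_part_commutator\<close>.\<close>
  define T where "T = (\<lambda>s i l. \<Sum>a\<in>UNIV. \<Sum>b\<in>UNIV. P i a * P s b * fano a b l)"
  have P_skew: "P i j = - P j i" and P_g2: "vec_part P l = 0" for i j l
    unfolding P_def using fano_closed_imp[of \<Gamma>, OF skew closed] by blast+
  have vec_part_\<Gamma>: "vec_part (\<Gamma> i) l = P i l" for i l
    by (simp add: P_def)
  \<comment> \<open>Differentiating closedness imposes the same linear conditions on the derivatives
    of the coefficients.\<close>
  have dP_skew: "dP s i j = - dP s j i" and dP_g2: "vec_part (dP s) l = 0" for s i j l
    unfolding dP_def using fano_closed_imp[of "d\<Gamma> s", OF dskew dclosed] by blast+
  have R_skew1: "R s i j k = - R i s j k" for s i j k
    unfolding R by (simp add: sum_subtractf algebra_simps)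
  have R_skew2: "R s i j k = - R s i k j" for s i j k
  proof -
    have "(\<Sum>b\<in>UNIV. \<Gamma> i k b * \<Gamma> s b j - \<Gamma> s k b * \<Gamma> i b j)
        = - (\<Sum>b\<in>UNIV. \<Gamma> i j b * \<Gamma> s b k - \<Gamma> s j b * \<Gamma> i b k)"
      unfolding sum_negf[symmetric]
      using skew by (intro sum.cong refl) (metis (no_types, lifting) minus_diff_eq minus_mult_minus mult.commute)
    moreover have "(\<Sum>a\<in>UNIV. (\<Gamma> s i a - \<Gamma> i s a) * \<Gamma> a k j)
        = - (\<Sum>a\<in>UNIV. (\<Gamma> s i a - \<Gamma> i s a) * \<Gamma> a j k)"
      unfolding sum_negf[symmetric] using skew by (intro sum.cong refl) (metis mult_minus_right)
    ultimately show ?thesis unfolding R using dskew[of s i j k] dskew[of i s j k] by simp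
  qed
  \<comment> \<open>The vector part of the structure equation. The commutator of the connection
    matrices supplies the terms of \<open>N\<close> acting on its last index, the bracket term those
    acting on the middle index.\<close>
  have K: "vec_part (R s i) l = N s i l - N i s l + T s i l / 2" for s i l
  proof -
    have "R s i = (\<lambda>j k. d\<Gamma> s i j k - d\<Gamma> i s j k
      + (\<Sum>b\<in>UNIV. \<Gamma> i j b * \<Gamma> s b k - \<Gamma> s j b * \<Gamma> i b k)
      - (\<Sum>a\<in>UNIV. (\<Gamma> s i a - \<Gamma> i s a) * \<Gamma> a j k))"
      using R by (intro ext)
    then have "vec_part (R s i) l = dP s i l - dP i s l
        + vec_part (\<lambda>j k. \<Sum>b\<in>UNIV. \<Gamma> i j b * \<Gamma> s b k - \<Gamma> s j b * \<Gamma> i b k) l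
        - (\<Sum>a\<in>UNIV. (\<Gamma> s i a - \<Gamma> i s a) * P a l)"
      by (simp only: vec_part_add vec_part_diff vec_part_sum vec_part_cmult dP_def P_def)
    then show ?thesis
      using vec_part_commutator[of "\<Gamma> i" "\<Gamma> s" l, OF skew skew]
      unfolding N_def T_def P_def by (simp add: sum_subtractf left_diff_distrib)
  qed
  have N_skew: "N s i l = - N s l i" for s i l
  proof -
    have "(\<Sum>c\<in>UNIV. \<Gamma> s l c * P i c) = - (\<Sum>c\<in>UNIV. \<Gamma> s l c * P c i)" for i l
      unfolding sum_negf[symmetric] by (intro sum.cong refl) (metis P_skew mult_minus_right)
    then show ?thesis
      unfolding N_def using dP_skew[of s i l] by simp
  qed
  \<comment> \<open>The connection need not preserve the Lie algebra of G2, so differentiating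
    \<open>vec_part P = 0\<close> leaves a product of two torsions.\<close>
  have N_trace: "vec_part (N i) k = - Sq i k" for i k
  proof -
    have "N i = (\<lambda>s l. dP i s l - (\<Sum>a\<in>UNIV. \<Gamma> i s a * P a l - P s a * \<Gamma> i a l))"
    proof (intro ext)
      fix s l
      have "(\<Sum>a\<in>UNIV. \<Gamma> i l a * P s a) = - (\<Sum>a\<in>UNIV. P s a * \<Gamma> i a l)"
        unfolding sum_negf[symmetric] using skew
        by (intro sum.cong refl) (metis mult.commute mult_minus_right)
      then show "N i s l = dP i s l - (\<Sum>a\<in>UNIV. \<Gamma> i s a * P a l - P s a * \<Gamma> i a l)"
        by (simp add: N_def sum_subtractf)
    qed
    then have "vec_part (N i) k = vec_part (dP i) k - vec_part (\<lambda>s l. \<Sum>a\<in>UNIV. \<Gamma> i s a * P a l - P s a * \<Gamma> i a l) k"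
      by (simp only: vec_part_diff)
    also have "\<dots> = (\<Sum>c\<in>UNIV. P k c * P i c)"
      using vec_part_commutator[of "\<Gamma> i" P k, OF skew P_skew] by (simp add: dP_g2 P_g2 sum_negf vec_part_\<Gamma>)
    also have "\<dots> = - Sq i k"
      unfolding Sq_def sum_negf[symmetric] using P_skew
      by (intro sum.cong refl) (metis mult.commute mult_minus_right)
    finally show ?thesis .
  qed
  \<comment> \<open>Contract \<open>K\<close> over \<open>s\<close> and \<open>l\<close>; the first
    Bianchi identity turns the left side into the Ricci tensor.\<close>
  have E1: "2 * (\<Sum>s\<in>UNIV. R s i k s) = C i k - Sq i k / 2" for i k
  proof -
    have "2 * (\<Sum>s\<in>UNIV. R s i k s) = vec_part (\<lambda>s l. vec_part (R s i) l) k"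
      using ricci_contraction[of "\<lambda>s. R s i" k] R_skew2
        bianchi_last_three[of R _ i, OF R_skew1 R_skew2 bianchi] by metis
    also have "\<dots> = vec_part (\<lambda>s l. N s i l - N i s l + (1/2) * T s i l) k"
      by (simp add: K)
    also have "\<dots> = C i k - vec_part (N i) k + (1/2) * vec_part (\<lambda>s l. T s i l) k"
      by (simp only: vec_part_add vec_part_diff vec_part_cmult C_def)
    also have "vec_part (\<lambda>s l. T s i l) k = (\<Sum>a\<in>UNIV. P i a * (- 3 * P a k))"
      unfolding g2_contraction[of P, OF P_skew P_g2, symmetric] T_def
      by (simp only: vec_part_sum[symmetric] vec_part_cmult[symmetric] sum_distrib_left mult.assoc)
    also have "\<dots> = - 3 * Sq i k"
      by (simp add: Sq_def sum_distrib_left algebra_simps)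
    finally show ?thesis by (simp add: N_trace)
  qed
  \<comment> \<open>Contract \<open>K\<close> over the curvature indices \<open>s\<close> and
    \<open>i\<close> instead. Antisymmetrisation doubles the curl, and skewness of \<open>N\<close>
    in its last two indices supplies the sign.\<close>
  have E2: "(if m = l then \<mu> else 0) = - 2 * C l m - 2 * Sq l m
      + (if l = m then (\<Sum>a\<in>UNIV. Sq a a) else 0) / 2" for l m
  proof -
    have "(if m = l then \<mu> else 0) = vec_part (\<lambda>s i. vec_part (R s i) l) m"
      unfolding star[symmetric] vec_part_def
      by (simp add: sum_distrib_left sum_distrib_right mult_ac)
    also have "\<dots> = vec_part (\<lambda>s i. N s i l - N i s l + (1/2) * T s i l) m"
      by (simp add: K)
    also have "\<dots> = vec_part (\<lambda>s i. N s i l) m - vec_part (\<lambda>s i. N i s l) m + (1/2) * vec_part (\<lambda>s i. T s i l) m"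
      by (simp only: vec_part_add vec_part_diff vec_part_cmult C_def)
    also have "vec_part (\<lambda>s i. N i s l) m = - vec_part (\<lambda>s i. N s i l) m"
      by (rule vec_part_transpose)
    also have "vec_part (\<lambda>s i. N s i l) m = - C l m"
      unfolding C_def vec_part_minus[symmetric] by (metis N_skew)
    also have "vec_part (\<lambda>s i. T s i l) m = - 4 * Sq l m + (if l = m then (\<Sum>a\<in>UNIV. Sq a a) else 0)"
      unfolding T_def Sq_def by (rule g2_square_contraction[of P, OF P_skew P_g2])
    finally show ?thesis by simp
  qed
  \<comment> \<open>Twice \<open>E1\<close> plus \<open>E2\<close> eliminates
    \<open>C\<close>.\<close>
  have "Sq l m = (if l = m then ((\<Sum>a\<in>UNIV. Sq a a) / 2 - \<mu> - 4 * \<kappa>) / 3 else 0)" for l m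
    using E1[of l m] E2[of m l] unfolding einstein by (auto split: if_splits)
  then have "P i j = 0" for i j
    unfolding Sq_def by (rule skew_square_scalar[of P, OF P_skew])
  then show ?thesis
    unfolding P_def by (intro fano_der_g2 skew)
qed

section \<open>Calculus of smooth functions\<close>

lemma Ck_on_Suc_D: "Ck_on (Suc k) S f \<Longrightarrow> Ck_on k S f"
proof (induction k arbitrary: f)
  case 0
  then show ?case
    by (auto intro!: continuous_at_imp_continuous_on differentiable_imp_continuous_within)
next
  case (Suc k)
  then show ?case by (metis Ck_on.simps(2))
qed

lemma Ck_on_subset: "Ck_on k S f \<Longrightarrow> T \<subseteq> S \<Longrightarrow> Ck_on k T f"
  by (induction k arbitrary: f) (auto intro: continuous_on_subset)

lemma Ck_on_cong:
  assumes "open S" "\<And>x. x \<in> S \<Longrightarrow> f x = g x" "Ck_on k S f"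
  shows "Ck_on k S g"
  using assms(2,3)
proof (induction k arbitrary: f g)
  case 0
  then show ?case by (metis Ck_on.simps(1) continuous_on_cong)
next
  case (Suc k)
  have eq: "f x = g x" if "x \<in> S" for x
    using Suc.prems(1)[OF that] .
  have f: "Ck_on (Suc k) S f"
    by (rule Suc.prems(2))
  have d: "(g has_derivative frechet_derivative f (at x)) (at x)" if "x \<in> S" for x
  proof (rule has_derivative_transform_within_open)
    show "(f has_derivative frechet_derivative f (at x)) (at x)"
      using f that by (simp add: frechet_derivative_works)
  qed (use assms(1) that eq in blast)+
  then have eq': "frechet_derivative f (at x) = frechet_derivative g (at x)" if "x \<in> S" for x
    using that frechet_derivative_at by metis
  have "Ck_on k S (\<lambda>x. frechet_derivative g (at x) u)" for u
    by (rule Suc.IH[of "\<lambda>x. frechet_derivative f (at x) u"]) (use f eq' in \<open>simp_all only: Ck_on.simps\<close>)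
  then show ?case
    using d by (auto simp: differentiable_def)
qed

text \<open>An explicit derivative lets the inductions below use the usual differentiation
  rules.\<close>

lemma Ck_on_SucI:
  assumes "open S" "\<And>x. x \<in> S \<Longrightarrow> (f has_derivative f' x) (at x)"
    and "\<And>u. Ck_on k S (\<lambda>x. f' x u)"
  shows "Ck_on (Suc k) S f"
proof -
  have "frechet_derivative f (at x) = f' x" if "x \<in> S" for x
    using assms(2)[OF that] frechet_derivative_at by metis
  then have "Ck_on k S (\<lambda>x. frechet_derivative f (at x) u)" for u
    by (intro Ck_on_cong[OF assms(1) _ assms(3)[of u]]) simp
  then show ?thesis using assms(2) by (auto simp: differentiable_def)
qed

lemma Ck_on_Suc_has_derivative:
  "Ck_on (Suc k) S f \<Longrightarrow> x \<in> S \<Longrightarrow> (f has_derivative frechet_derivative f (at x)) (at x)"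
  by (simp add: frechet_derivative_works)

lemma Ck_on_const: "open S \<Longrightarrow> Ck_on k S (\<lambda>x. c)"
proof (induction k arbitrary: c)
  case (Suc k)
  then show ?case by (intro Ck_on_SucI[where f' = "\<lambda>_ _. 0"]) auto
qed simp

lemma Ck_on_add:
  assumes "open S" "Ck_on k S f" "Ck_on k S g"
  shows "Ck_on k S (\<lambda>x. f x + g x)"
  using assms(2,3)
proof (induction k arbitrary: f g)
  case 0
  then show ?case by (auto intro: continuous_intros)
next
  case (Suc k)
  show ?case
    by (rule Ck_on_SucI[OF assms(1) has_derivative_add[OF Ck_on_Suc_has_derivative Ck_on_Suc_has_derivative]])
      (use Suc in auto)
qed

lemma Ck_on_sum:
  "open S \<Longrightarrow> (\<And>i. i \<in> I \<Longrightarrow> Ck_on k S (f i)) \<Longrightarrow> Ck_on k S (\<lambda>x. \<Sum>i\<in>I. f i x)"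
  by (induction I rule: infinite_finite_induct) (auto intro: Ck_on_const Ck_on_add)

text \<open>One induction, general in both factors because the product rule differentiates each of
  them, covers multiplication, scaling and inner products.\<close>

lemma Ck_on_bilinear:
  assumes "bounded_bilinear prd" "open S" "Ck_on k S f" "Ck_on k S g"
  shows "Ck_on k S (\<lambda>x. prd (f x) (g x))"
  using assms(3,4)
proof (induction k arbitrary: f g)
  case 0
  then show ?case by (auto intro: bounded_bilinear.continuous_on[OF assms(1)])
next
  case (Suc k)
  note IH = Suc.IH and p = Suc.prems
  show ?case
  proof (rule Ck_on_SucI[OF assms(2) bounded_bilinear.FDERIV[OF assms(1)]])
    fix x assume "x \<in> S"
    then show "(f has_derivative frechet_derivative f (at x)) (at x)"
      "(g has_derivative frechet_derivative g (at x)) (at x)"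
      using p Ck_on_Suc_has_derivative by blast+
  next
    fix u
    show "Ck_on k S (\<lambda>x. prd (f x) (frechet_derivative g (at x) u) + prd (frechet_derivative f (at x) u) (g x))"
      using p by (intro Ck_on_add assms(2) IH Ck_on_Suc_D[of k S f] Ck_on_Suc_D[of k S g]) auto
  qed
qed

lemmas Ck_on_mult = Ck_on_bilinear[OF bounded_bilinear_mult]
  and Ck_on_scaleR = Ck_on_bilinear[OF bounded_bilinear_scaleR]
  and Ck_on_inner = Ck_on_bilinear[OF bounded_bilinear_inner]

lemma Ck_on_prod:
  fixes f :: "'i \<Rightarrow> 'a::euclidean_space \<Rightarrow> 'b::{real_normed_algebra, comm_ring_1}"
  shows "open S \<Longrightarrow> (\<And>i. i \<in> I \<Longrightarrow> Ck_on k S (f i)) \<Longrightarrow> Ck_on k S (\<lambda>x. \<Prod>i\<in>I. f i x)"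
  by (induction I rule: infinite_finite_induct) (auto intro: Ck_on_const Ck_on_mult)

text \<open>The derivative of the inverse is a product of the inverse itself and the derivative of
  \<open>f\<close>, so the induction runs with \<open>f\<close> fixed.\<close>

lemma Ck_on_inverse:
  fixes f :: "'a::euclidean_space \<Rightarrow> real"
  assumes "open S" "Ck_on k S f" "\<And>x. x \<in> S \<Longrightarrow> f x \<noteq> 0"
  shows "Ck_on k S (\<lambda>x. inverse (f x))"
  using assms(2)
proof (induction k)
  case 0
  then show ?case using assms(3) by (auto intro: continuous_on_inverse)
next
  case (Suc k)
  note IH = Suc.IH[OF Ck_on_Suc_D[OF Suc.prems]]
  show ?case
  proof (rule Ck_on_SucI[OF assms(1)])
    fix x assume "x \<in> S"
    then show "((\<lambda>x. inverse (f x)) has_derivative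
        (\<lambda>h. (- 1) * (inverse (f x) * frechet_derivative f (at x) h * inverse (f x)))) (at x)"
      using Deriv.has_derivative_inverse[OF assms(3) Ck_on_Suc_has_derivative[OF Suc.prems]] by simp
  next
    fix u
    show "Ck_on k S (\<lambda>x. (- 1) * (inverse (f x) * frechet_derivative f (at x) u * inverse (f x)))"
      using Suc.prems by (intro Ck_on_mult Ck_on_const assms(1) IH) auto
  qed
qed

lemma Ck_on_vec:
  fixes f :: "'i::finite \<Rightarrow> 'a::euclidean_space \<Rightarrow> real"
  assumes "open S" "\<And>i. Ck_on k S (f i)"
  shows "Ck_on k S (\<lambda>x. \<chi> i. f i x)"
proof -
  have "(\<chi> i. f i x) = (\<Sum>i\<in>UNIV. f i x *\<^sub>R axis i 1)" for x
    by (simp add: vec_eq_iff axis_def if_distrib cong: if_cong)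
  then show ?thesis
    by (auto intro!: Ck_on_sum Ck_on_scaleR Ck_on_const assms)
qed

lemma Ck_on_nth:
  fixes f :: "'a::euclidean_space \<Rightarrow> real^'n"
  assumes "open S" "Ck_on k S f"
  shows "Ck_on k S (\<lambda>x. f x $ i)"
proof -
  have "Ck_on k S (\<lambda>x. f x \<bullet> axis i 1)"
    by (intro Ck_on_inner Ck_on_const assms)
  then show ?thesis by (simp add: inner_axis)
qed

lemma Ck_on_det:
  fixes A :: "'a::euclidean_space \<Rightarrow> real^'n^'n"
  assumes "open S" "\<And>i j. Ck_on k S (\<lambda>x. A x $ i $ j)"
  shows "Ck_on k S (\<lambda>x. det (A x))"
  unfolding det_def by (intro Ck_on_sum Ck_on_mult Ck_on_prod Ck_on_const assms)

lemma smooth_on_has_derivative: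
  "smooth_on S f \<Longrightarrow> x \<in> S \<Longrightarrow> (f has_derivative frechet_derivative f (at x)) (at x)"
  unfolding smooth_on_def by (metis Ck_on_Suc_has_derivative)

lemma smooth_on_frechet_derivative:
  "smooth_on S f \<Longrightarrow> smooth_on S (\<lambda>x. frechet_derivative f (at x) u)"
  unfolding smooth_on_def by (metis Ck_on.simps(2))

lemma smooth_on_cong:
  "open S \<Longrightarrow> (\<And>x. x \<in> S \<Longrightarrow> f x = g x) \<Longrightarrow> smooth_on S f \<Longrightarrow> smooth_on S g"
  unfolding smooth_on_def using Ck_on_cong by blast

section \<open>Symmetry of second derivatives\<close>

lemma symmetric_second_derivative:
  fixes f :: "'a::real_normed_vector \<Rightarrow> real"
  assumes "open S" "x \<in> S"
    and f': "\<And>y. y \<in> S \<Longrightarrow> (f has_derivative f' y) (at y)"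
    and hu: "((\<lambda>y. f' y u) has_derivative hu) (at x)"
    and hv: "((\<lambda>y. f' y v) has_derivative hv) (at x)"
  shows "hu v = hv u"
proof -
  \<comment> \<open>Both mixed derivatives are the limit of the same second difference quotient.\<close>
  have approx: "\<exists>d>0. \<forall>t. 0 < t \<and> t < d \<longrightarrow>
      \<bar>f (x + t *\<^sub>R (u + v)) - f (x + t *\<^sub>R u) - f (x + t *\<^sub>R v) + f x - t\<^sup>2 * h v\<bar> \<le> \<epsilon> * t\<^sup>2"
    if h: "((\<lambda>y. f' y u) has_derivative h) (at x)" and "\<epsilon> > 0" for u v h \<epsilon>
  proof -
    \<comment> \<open>All points of the parallelogram spanned by \<open>u\<close> and
      \<open>v\<close> scaled by \<open>t\<close> are within \<open>t * B\<close> of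
      \<open>x\<close>. The summand 1 keeps \<open>B\<close> positive when both vectors
      vanish.\<close>
    define B where "B = norm u + norm v + 1"
    have B: "B > 0" by (simp add: B_def add_nonneg_pos)
    obtain r where r: "r > 0" "ball x r \<subseteq> S"
      using assms(1,2) by (meson openE)
    have "\<exists>d>0. \<forall>y. norm (y - x) < d \<longrightarrow>
        norm (f' y u - f' x u - h (y - x)) \<le> (\<epsilon> / (2 * B)) * norm (y - x)"
    proof -
      have "\<forall>e>0. \<exists>d>0. \<forall>y. norm (y - x) < d \<longrightarrow> norm (f' y u - f' x u - h (y - x)) \<le> e * norm (y - x)"
        using h unfolding has_derivative_at_alt by blast
      moreover have "\<epsilon> / (2 * B) > 0" using \<open>\<epsilon> > 0\<close> B by simp
      ultimately show ?thesis by blast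
    qed
    then obtain d0 where "d0 > 0" and d0': "\<And>y. norm (y - x) < d0 \<Longrightarrow>
        norm (f' y u - f' x u - h (y - x)) \<le> (\<epsilon> / (2 * B)) * norm (y - x)" by blast
    have d0: "\<bar>f' (x + w) u - f' x u - h w\<bar> \<le> (\<epsilon> / (2 * B)) * norm w" if "norm w < d0" for w
      using d0'[of "x + w"] that by simp
    have lin: "linear h" using h has_derivative_linear by blast
    define d where "d = min d0 r / B"
    have "d > 0" using \<open>d0 > 0\<close> r B by (simp add: d_def)
    moreover have "\<bar>f (x + t *\<^sub>R (u + v)) - f (x + t *\<^sub>R u) - f (x + t *\<^sub>R v) + f x - t\<^sup>2 * h v\<bar> \<le> \<epsilon> * t\<^sup>2"
      if t: "0 < t" "t < d" for t
    proof -
      have tB: "t * B < min d0 r" using t B by (simp add: d_def field_simps)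
      have small: "norm (s *\<^sub>R u + q *\<^sub>R v) \<le> t * B" if "0 \<le> s" "s \<le> t" "0 \<le> q" "q \<le> t" for s q
      proof -
        have "norm (s *\<^sub>R u + q *\<^sub>R v) \<le> s * norm u + q * norm v"
          using that norm_triangle_ineq[of "s *\<^sub>R u" "q *\<^sub>R v"] by simp
        also have "\<dots> \<le> t * norm u + t * norm v"
          using that by (intro add_mono mult_right_mono) auto
        also have "\<dots> \<le> t * B" using t by (simp add: B_def algebra_simps)
        finally show ?thesis .
      qed
      have inS: "x + (s *\<^sub>R u + q *\<^sub>R v) \<in> S" if "0 \<le> s" "s \<le> t" "0 \<le> q" "q \<le> t" for s q
      proof -
        have "dist x (x + w) = norm w" for w
          by (simp add: dist_norm)
        then show ?thesis using small[OF that] tB r(2) by (intro subsetD[OF r(2)]) simp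
      qed
      \<comment> \<open>The increment in direction \<open>v\<close> as a function of the position
        along \<open>u\<close>. Then \<open>F t - F 0\<close> is the second difference, and the mean
        value theorem reduces it to first derivatives. The zero multiple of \<open>v\<close> lets
        \<open>der\<close> apply to both terms.\<close>
      define F where "F = (\<lambda>s. f (x + (s *\<^sub>R u + t *\<^sub>R v)) - f (x + (s *\<^sub>R u + 0 *\<^sub>R v)))"
      have der: "((\<lambda>s. f (x + (s *\<^sub>R u + q *\<^sub>R v))) has_real_derivative f' (x + (s *\<^sub>R u + q *\<^sub>R v)) u) (at s)"
        if "0 \<le> s" "s \<le> t" "0 \<le> q" "q \<le> t" for s q
      proof -
        have line: "((\<lambda>s. x + (s *\<^sub>R u + q *\<^sub>R v)) has_derivative (\<lambda>k. k *\<^sub>R u)) (at s)"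
          by (auto intro!: derivative_eq_intros)
        have "((\<lambda>s. f (x + (s *\<^sub>R u + q *\<^sub>R v))) has_derivative
            (\<lambda>k. f' (x + (s *\<^sub>R u + q *\<^sub>R v)) (k *\<^sub>R u))) (at s)"
          by (rule has_derivative_compose[OF line f'[OF inS[OF that]]])
        moreover have "f' (x + (s *\<^sub>R u + q *\<^sub>R v)) (k *\<^sub>R u) = k * f' (x + (s *\<^sub>R u + q *\<^sub>R v)) u" for k
          using linear_cmul[OF has_derivative_linear[OF f'[OF inS[OF that]]]] by simp
        ultimately show ?thesis
          by (simp add: has_field_derivative_def mult.commute[of _ "f' _ u"])
      qed
      have "\<exists>z>0. z < t \<and> F t - F 0 = (t - 0) * (f' (x + (z *\<^sub>R u + t *\<^sub>R v)) u - f' (x + (z *\<^sub>R u + 0 *\<^sub>R v)) u)"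
        using t unfolding F_def by (intro MVT2 DERIV_diff der) auto
      then obtain z where z: "0 < z" "z < t"
        "F t - F 0 = t * (f' (x + (z *\<^sub>R u + t *\<^sub>R v)) u - f' (x + (z *\<^sub>R u + 0 *\<^sub>R v)) u)" by auto
      let ?a = "z *\<^sub>R u + t *\<^sub>R v" and ?b = "z *\<^sub>R u + 0 *\<^sub>R v"
      \<comment> \<open>The two corners \<open>?a\<close> and \<open>?b\<close> each use up half of
        the tolerance.\<close>
      have "\<bar>f' (x + w) u - f' x u - h w\<bar> \<le> \<epsilon> / 2 * t" if "norm w \<le> t * B" for w
      proof -
        have "\<bar>f' (x + w) u - f' x u - h w\<bar> \<le> (\<epsilon> / (2 * B)) * norm w"
          using that tB by (intro d0) auto
        also have "\<dots> \<le> (\<epsilon> / (2 * B)) * (t * B)"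
          using that \<open>\<epsilon> > 0\<close> B by (intro mult_left_mono) auto
        finally show ?thesis using B by simp
      qed
      note this[OF small[of z t]] this[OF small[of z 0]]
      then
      have "\<bar>(f' (x + ?a) u - f' (x + ?b) u) - (h ?a - h ?b)\<bar> \<le> \<epsilon> * t"
        using z t by linarith
      moreover have "h ?a - h ?b = t * h v"
        using lin by (simp add: linear_add linear_cmul)
      ultimately have "t * \<bar>(f' (x + ?a) u - f' (x + ?b) u) - t * h v\<bar> \<le> t * (\<epsilon> * t)"
        using t by (intro mult_left_mono) auto
      then have "\<bar>t * ((f' (x + ?a) u - f' (x + ?b) u) - t * h v)\<bar> \<le> t * (\<epsilon> * t)"
        using t by (simp only: abs_mult)
      then have "\<bar>(F t - F 0) - t\<^sup>2 * h v\<bar> \<le> \<epsilon> * t\<^sup>2"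
        unfolding z(3) by (simp add: power2_eq_square algebra_simps)
      moreover have "F t - F 0 = f (x + t *\<^sub>R (u + v)) - f (x + t *\<^sub>R u) - f (x + t *\<^sub>R v) + f x"
        by (simp add: F_def scaleR_add_right)
      ultimately show ?thesis by simp
    qed
    ultimately show ?thesis by blast
  qed
  have "\<bar>hu v - hv u\<bar> \<le> 0 + \<epsilon>" if "\<epsilon> > 0" for \<epsilon>
  proof -
    have "\<epsilon> / 2 > 0" using that by simp
    obtain d1 where d1: "d1 > 0" "\<And>t. 0 < t \<and> t < d1 \<Longrightarrow>
      \<bar>f (x + t *\<^sub>R (u + v)) - f (x + t *\<^sub>R u) - f (x + t *\<^sub>R v) + f x - t\<^sup>2 * hu v\<bar> \<le> \<epsilon> / 2 * t\<^sup>2"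
      using approx[OF hu \<open>\<epsilon> / 2 > 0\<close>, of v] by blast
    obtain d2 where d2: "d2 > 0" "\<And>t. 0 < t \<and> t < d2 \<Longrightarrow>
      \<bar>f (x + t *\<^sub>R (v + u)) - f (x + t *\<^sub>R v) - f (x + t *\<^sub>R u) + f x - t\<^sup>2 * hv u\<bar> \<le> \<epsilon> / 2 * t\<^sup>2"
      using approx[OF hv \<open>\<epsilon> / 2 > 0\<close>, of u] by blast
    define t where "t = min d1 d2 / 2"
    have t: "0 < t" "t < d1" "t < d2" using d1 d2 by (auto simp: t_def)
    have "\<bar>t\<^sup>2 * hu v - t\<^sup>2 * hv u\<bar> \<le> \<epsilon> * t\<^sup>2"
      using d1(2)[of t] d2(2)[of t] t unfolding add.commute[of v u] by argo
    then have "t\<^sup>2 * \<bar>hu v - hv u\<bar> \<le> t\<^sup>2 * \<epsilon>"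
      by (simp only: right_diff_distrib[symmetric] abs_mult abs_power2 mult.commute[of \<epsilon>])
    then show ?thesis using t by simp
  qed
  then show ?thesis
    using field_le_epsilon[of "\<bar>hu v - hv u\<bar>" 0] by simp
qed

lemma smooth_on_sum:
  "open S \<Longrightarrow> (\<And>i. i \<in> I \<Longrightarrow> smooth_on S (f i)) \<Longrightarrow> smooth_on S (\<lambda>x. \<Sum>i\<in>I. f i x)"
  unfolding smooth_on_def by (auto intro: Ck_on_sum)

lemma smooth_on_add:
  "open S \<Longrightarrow> smooth_on S f \<Longrightarrow> smooth_on S g \<Longrightarrow> smooth_on S (\<lambda>x. f x + g x)"
  unfolding smooth_on_def by (auto intro: Ck_on_add)

lemma smooth_on_scaleR:
  "open S \<Longrightarrow> smooth_on S f \<Longrightarrow> smooth_on S g \<Longrightarrow> smooth_on S (\<lambda>x. f x *\<^sub>R g x)"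
  unfolding smooth_on_def by (auto intro: Ck_on_scaleR)

lemma smooth_on_inner:
  "open S \<Longrightarrow> smooth_on S f \<Longrightarrow> smooth_on S g \<Longrightarrow> smooth_on S (\<lambda>x. f x \<bullet> g x)"
  unfolding smooth_on_def by (auto intro: Ck_on_inner)

lemma smooth_on_nth:
  fixes f :: "'a::euclidean_space \<Rightarrow> real^'n"
  shows "open S \<Longrightarrow> smooth_on S f \<Longrightarrow> smooth_on S (\<lambda>x. f x $ i)"
  unfolding smooth_on_def by (auto intro: Ck_on_nth)

text \<open>The hypotheses control \<open>F x u\<close> only for fixed \<open>u\<close>; expanding
  \<open>Y x\<close> in the standard basis reduces the varying argument to products of smooth
  functions.\<close>

lemma smooth_on_apply_linear:
  fixes F :: "'a::euclidean_space \<Rightarrow> real^'n::finite \<Rightarrow> 'b::real_normed_vector"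
  assumes "open S" "\<And>x. x \<in> S \<Longrightarrow> linear (F x)" "\<And>u. smooth_on S (\<lambda>x. F x u)" "smooth_on S Y"
  shows "smooth_on S (\<lambda>x. F x (Y x))"
proof (rule smooth_on_cong[OF assms(1)])
  show "smooth_on S (\<lambda>x. \<Sum>p\<in>UNIV. (Y x $ p) *\<^sub>R F x (axis p 1))"
    by (intro smooth_on_sum smooth_on_scaleR smooth_on_nth assms)
  fix x assume "x \<in> S"
  then have l: "linear (F x)" by (rule assms(2))
  have "Y x = (\<Sum>p\<in>UNIV. (Y x $ p) *\<^sub>R axis p 1)"
    by (simp add: vec_eq_iff axis_def if_distrib cong: if_cong)
  then show "(\<Sum>p\<in>UNIV. (Y x $ p) *\<^sub>R F x (axis p 1)) = F x (Y x)"
    using linear_sum[OF l, of "\<lambda>p. (Y x $ p) *\<^sub>R axis p 1" UNIV] linear_cmul[OF l] by simp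
qed

lemma has_derivative_apply_linear:
  fixes F :: "'a::real_normed_vector \<Rightarrow> real^'n::finite \<Rightarrow> 'b::real_normed_vector"
  assumes "open S" "x \<in> S" "\<And>y. y \<in> S \<Longrightarrow> linear (F y)"
    and F': "\<And>u. ((\<lambda>y. F y u) has_derivative F' u) (at x)"
    and Y': "(Y has_derivative Y') (at x)"
  shows "((\<lambda>y. F y (Y y)) has_derivative (\<lambda>t. F x (Y' t) + F' (Y x) t)) (at x)"
proof -
  have exp: "F y w = (\<Sum>p\<in>UNIV. (w $ p) *\<^sub>R F y (axis p 1))" if "y \<in> S" for y w
  proof -
    have l: "linear (F y)" using that by (rule assms(3))
    have "w = (\<Sum>p\<in>UNIV. (w $ p) *\<^sub>R axis p 1)"
      by (simp add: vec_eq_iff axis_def if_distrib cong: if_cong)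
    then show ?thesis
      using linear_sum[OF l, of "\<lambda>p. (w $ p) *\<^sub>R axis p 1" UNIV] linear_cmul[OF l] by simp
  qed
  have nth: "((\<lambda>y. Y y $ p) has_derivative (\<lambda>t. Y' t $ p)) (at x)" for p
    by (rule bounded_linear.has_derivative[OF bounded_linear_vec_nth Y'])
  \<comment> \<open>Uniqueness of the derivative will show that \<open>F'\<close> may be expanded in
    its first argument at \<open>Y x\<close>.\<close>
  have "((\<lambda>y. \<Sum>p\<in>UNIV. (Y x $ p) *\<^sub>R F y (axis p 1)) has_derivative
      (\<lambda>t. \<Sum>p\<in>UNIV. (Y x $ p) *\<^sub>R F' (axis p 1) t)) (at x)"
    by (intro has_derivative_sum has_derivative_scaleR_right F')
  then have "((\<lambda>y. F y (Y x)) has_derivative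
      (\<lambda>t. \<Sum>p\<in>UNIV. (Y x $ p) *\<^sub>R F' (axis p 1) t)) (at x)"
    by (rule has_derivative_transform_within_open[OF _ assms(1,2)]) (simp add: exp[symmetric])
  then have F'_exp: "F' (Y x) = (\<lambda>t. \<Sum>p\<in>UNIV. (Y x $ p) *\<^sub>R F' (axis p 1) t)"
    by (rule has_derivative_unique[OF F'])
  have "((\<lambda>y. \<Sum>p\<in>UNIV. (Y y $ p) *\<^sub>R F y (axis p 1)) has_derivative
      (\<lambda>t. \<Sum>p\<in>UNIV. (Y x $ p) *\<^sub>R F' (axis p 1) t + (Y' t $ p) *\<^sub>R F x (axis p 1))) (at x)"
    by (intro has_derivative_sum has_derivative_scaleR nth F')
  then have "((\<lambda>y. F y (Y y)) has_derivative
      (\<lambda>t. \<Sum>p\<in>UNIV. (Y x $ p) *\<^sub>R F' (axis p 1) t + (Y' t $ p) *\<^sub>R F x (axis p 1))) (at x)"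
    by (rule has_derivative_transform_within_open[OF _ assms(1,2)]) (simp add: exp[symmetric])
  then show ?thesis
    unfolding F'_exp exp[OF assms(2), of "Y' _"] by (simp add: sum.distrib add.commute)
qed

lemma symmetric_frechet_derivative:
  fixes Z :: "real^'n::finite \<Rightarrow> real^'m"
  assumes "open S" "x \<in> S" "smooth_on S Z"
  shows "D (\<lambda>y. D Z y u) x v = D (\<lambda>y. D Z y v) x u"
proof -
  have "D (\<lambda>y. D Z y u) x v $ p = D (\<lambda>y. D Z y v) x u $ p" for p
  proof (rule symmetric_second_derivative[OF assms(1,2)])
    show "((\<lambda>y. Z y $ p) has_derivative (\<lambda>w. D Z y w $ p)) (at y)" if "y \<in> S" for y
      using that assms(3)
      by (intro bounded_linear.has_derivative[OF bounded_linear_vec_nth] smooth_on_has_derivative)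
    show "((\<lambda>y. D Z y u $ p) has_derivative (\<lambda>w. D (\<lambda>y. D Z y u) x w $ p)) (at x)" for u
      using assms(2,3)
      by (intro bounded_linear.has_derivative[OF bounded_linear_vec_nth]
          smooth_on_has_derivative[of S "\<lambda>y. D Z y u"] smooth_on_frechet_derivative)
    then show "((\<lambda>y. D Z y v $ p) has_derivative (\<lambda>w. D (\<lambda>y. D Z y v) x w $ p)) (at x)" .
  qed
  then show ?thesis by (simp add: vec_eq_iff)
qed

lemma linear_frechet_derivative_smooth:
  "smooth_on S f \<Longrightarrow> x \<in> S \<Longrightarrow> linear (frechet_derivative f (at x))"
  using smooth_on_has_derivative has_derivative_linear by blast

lemma smooth_on_cov_deriv:
  assumes "open S" "smooth_on S Y" "smooth_on S Z"
    and "\<And>x. x \<in> S \<Longrightarrow> bilinear (\<Gamma> x)" "\<And>u v. smooth_on S (\<lambda>x. \<Gamma> x u v)"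
  shows "smooth_on S (cov_deriv \<Gamma> Y Z)"
proof -
  note linear_Z = linear_frechet_derivative_smooth[OF assms(3)]
  have "smooth_on S (\<lambda>x. D Z x (Y x))"
    by (rule smooth_on_apply_linear[OF assms(1) linear_Z smooth_on_frechet_derivative[OF assms(3)] assms(2)])
  moreover have "smooth_on S (\<lambda>x. \<Gamma> x u (Z x))" for u
    using assms(4) by (intro smooth_on_apply_linear[OF assms(1) _ assms(5,3)]) (auto simp: bilinear_def)
  then have "smooth_on S (\<lambda>x. \<Gamma> x (Y x) (Z x))"
    using assms(4) by (intro smooth_on_apply_linear[OF assms(1) _ _ assms(2), of "\<lambda>x u. \<Gamma> x u (Z x)"])
      (auto simp: bilinear_def)
  ultimately show ?thesis
    unfolding cov_deriv_def by (rule smooth_on_add[OF assms(1)])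
qed

section \<open>The Jacobi identity and the first Bianchi identity\<close>

text \<open>The terms with only first derivatives cancel in pairs; those with second derivatives,
  collected in \<open>H\<close>, cancel by their symmetry.\<close>

lemma jacobi_lie_bracket:
  fixes X Y Z :: "real^'n::finite \<Rightarrow> real^'n"
  assumes "open S" "x \<in> S" "smooth_on S X" "smooth_on S Y" "smooth_on S Z"
  shows "lie_bracket X (lie_bracket Y Z) x + lie_bracket Y (lie_bracket Z X) x
    + lie_bracket Z (lie_bracket X Y) x = 0"
proof -
  define H where "H Z v t = D (\<lambda>y. D Z y v) x t" for Z :: "real^'n \<Rightarrow> real^'n" and v t
  have inner: "((\<lambda>y. D Z y (Y y)) has_derivative (\<lambda>t. D Z x (D Y x t) + H Z (Y x) t)) (at x)"
    if "smooth_on S Y" "smooth_on S Z" for Y Z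
    unfolding H_def
    using that assms(1,2)
    by (intro has_derivative_apply_linear[where S = S and F = "\<lambda>y. D Z y"]
        linear_frechet_derivative_smooth smooth_on_has_derivative[of S] smooth_on_frechet_derivative)
  have bracket: "D (lie_bracket Y Z) x =
      (\<lambda>t. (D Z x (D Y x t) + H Z (Y x) t) - (D Y x (D Z x t) + H Y (Z x) t))"
    if "smooth_on S Y" "smooth_on S Z" for Y Z
  proof (rule sym, rule frechet_derivative_at)
    show "(lie_bracket Y Z has_derivative
        (\<lambda>t. (D Z x (D Y x t) + H Z (Y x) t) - (D Y x (D Z x t) + H Y (Z x) t))) (at x)"
      unfolding lie_bracket_def using that by (intro has_derivative_diff inner)
  qed
  have D_bracket: "D X x (lie_bracket Y Z x) = D X x (D Z x (Y x)) - D X x (D Y x (Z x))"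
    if "smooth_on S X" for X Y Z :: "real^'n \<Rightarrow> real^'n"
    unfolding lie_bracket_def
    using linear_frechet_derivative_smooth[OF that assms(2)] by (rule linear_diff)
  have H_sym: "H Z v t = H Z t v" if "smooth_on S Z" for Z v t
    unfolding H_def using assms(1,2) that by (rule symmetric_frechet_derivative)
  have "lie_bracket X (lie_bracket Y Z) x = D Z x (D Y x (X x)) + H Z (Y x) (X x)
      - (D Y x (D Z x (X x)) + H Y (Z x) (X x)) - (D X x (D Z x (Y x)) - D X x (D Y x (Z x)))"
    if "smooth_on S X" "smooth_on S Y" "smooth_on S Z" for X Y Z
    unfolding lie_bracket_def[of X] using bracket D_bracket that by simp
  note expand = this[OF assms(3,4,5)] this[OF assms(4,5,3)] this[OF assms(5,3,4)]
  show ?thesis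
    \<comment> \<open>Each of the three Hessians occurs twice with its arguments exchanged; one
      instance per field aligns them.\<close>
    unfolding expand H_sym[OF assms(3), of "Z x" "Y x"] H_sym[OF assms(4), of "X x" "Z x"]
      H_sym[OF assms(5), of "Y x" "X x"]
    by (simp only: algebra_simps add_0)
qed

text \<open>Vanishing torsion turns the cyclic sum of curvatures into the cyclic sum of iterated
  brackets, which is zero by the Jacobi identity.\<close>

lemma first_bianchi:
  assumes "open S" "x \<in> S" "smooth_on S X" "smooth_on S Y" "smooth_on S Z"
    and bil: "\<And>y. y \<in> S \<Longrightarrow> bilinear (\<Gamma> y)" and smooth: "\<And>u v. smooth_on S (\<lambda>y. \<Gamma> y u v)"
    and sym: "\<And>y u v. y \<in> S \<Longrightarrow> \<Gamma> y u v = \<Gamma> y v u"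
  shows "curvature \<Gamma> X Y Z x + curvature \<Gamma> Y Z X x + curvature \<Gamma> Z X Y x = 0"
proof -
  have torsion: "cov_deriv \<Gamma> Y Z y - cov_deriv \<Gamma> Z Y y = lie_bracket Y Z y" if "y \<in> S" for Y Z y
    using sym[OF that, of "Y y" "Z y"] by (simp add: cov_deriv_def lie_bracket_def)
  \<comment> \<open>Vanishing torsion enters twice: for \<open>Y\<close> and \<open>Z\<close> inside
    the derivative, then for \<open>X\<close> and \<open>lie_bracket Y Z\<close>.\<close>
  have step: "cov_deriv \<Gamma> X (cov_deriv \<Gamma> Y Z) x - cov_deriv \<Gamma> X (cov_deriv \<Gamma> Z Y) x
      - cov_deriv \<Gamma> (lie_bracket Y Z) X x = lie_bracket X (lie_bracket Y Z) x"
    if "smooth_on S X" "smooth_on S Y" "smooth_on S Z" for X Y Z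
  proof -
    have d: "(cov_deriv \<Gamma> Y Z has_derivative D (cov_deriv \<Gamma> Y Z) x) (at x)"
      if "smooth_on S Y" "smooth_on S Z" for Y Z
      by (rule smooth_on_has_derivative[OF smooth_on_cov_deriv[OF assms(1) that bil smooth] assms(2)])
    have "((\<lambda>y. cov_deriv \<Gamma> Y Z y - cov_deriv \<Gamma> Z Y y) has_derivative
        (\<lambda>t. D (cov_deriv \<Gamma> Y Z) x t - D (cov_deriv \<Gamma> Z Y) x t)) (at x)"
      using that by (intro has_derivative_diff d)
    then have "(lie_bracket Y Z has_derivative
        (\<lambda>t. D (cov_deriv \<Gamma> Y Z) x t - D (cov_deriv \<Gamma> Z Y) x t)) (at x)"
      by (rule has_derivative_transform_within_open[OF _ assms(1,2)]) (rule torsion)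
    then have "D (lie_bracket Y Z) x t = D (cov_deriv \<Gamma> Y Z) x t - D (cov_deriv \<Gamma> Z Y) x t" for t
      by (rule frechet_derivative_at[symmetric, THEN fun_cong])
    then have "cov_deriv \<Gamma> X (cov_deriv \<Gamma> Y Z) x - cov_deriv \<Gamma> X (cov_deriv \<Gamma> Z Y) x
        = cov_deriv \<Gamma> X (lie_bracket Y Z) x"
      unfolding cov_deriv_def[of \<Gamma> X]
      by (simp add: torsion[OF assms(2), symmetric] bilinear_rsub[OF bil[OF assms(2)]])
    then show ?thesis
      using torsion[OF assms(2), of X "lie_bracket Y Z"] by simp
  qed
  have "curvature \<Gamma> X Y Z x + curvature \<Gamma> Y Z X x + curvature \<Gamma> Z X Y x =
      (cov_deriv \<Gamma> X (cov_deriv \<Gamma> Y Z) x - cov_deriv \<Gamma> X (cov_deriv \<Gamma> Z Y) x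
        - cov_deriv \<Gamma> (lie_bracket Y Z) X x)
    + (cov_deriv \<Gamma> Y (cov_deriv \<Gamma> Z X) x - cov_deriv \<Gamma> Y (cov_deriv \<Gamma> X Z) x
        - cov_deriv \<Gamma> (lie_bracket Z X) Y x)
    + (cov_deriv \<Gamma> Z (cov_deriv \<Gamma> X Y) x - cov_deriv \<Gamma> Z (cov_deriv \<Gamma> Y X) x
        - cov_deriv \<Gamma> (lie_bracket X Y) Z x)"
    unfolding curvature_def by (simp only: algebra_simps add_0)
  also have "\<dots> = 0"
    unfolding step[OF assms(3,4,5)] step[OF assms(4,5,3)] step[OF assms(5,3,4)]
    by (rule jacobi_lie_bracket[OF assms(1-5)])
  finally show ?thesis .
qed

section \<open>Moving frames\<close>

text \<open>The metric is the one for which \<open>\<theta>\<close> is orthonormal.\<close>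

locale moving_coframe =
  fixes V :: "(real^'n::finite) set"
    and \<theta> :: "'n \<Rightarrow> real^'n \<Rightarrow> real^'n"
    and \<Gamma> :: "real^'n \<Rightarrow> real^'n \<Rightarrow> real^'n \<Rightarrow> real^'n"
  assumes open_V: "open V"
    and smooth_\<theta>: "\<And>i. smooth_on V (\<theta> i)"
    and independent_\<theta>: "\<And>y. y \<in> V \<Longrightarrow> inj (\<lambda>i. \<theta> i y) \<and> independent (range (\<lambda>i. \<theta> i y))"
    and bilinear_\<Gamma>: "\<And>y. y \<in> V \<Longrightarrow> bilinear (\<Gamma> y)"
    and smooth_\<Gamma>: "\<And>u v. smooth_on V (\<lambda>y. \<Gamma> y u v)"
    and symmetric_\<Gamma>: "\<And>y u v. y \<in> V \<Longrightarrow> \<Gamma> y u v = \<Gamma> y v u"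
    and metric_\<Gamma>: "\<And>y u v w. y \<in> V \<Longrightarrow>
      D (\<lambda>z. \<Sum>i\<in>UNIV. (\<theta> i z \<bullet> v) * (\<theta> i z \<bullet> w)) y u =
      (\<Sum>i\<in>UNIV. (\<theta> i y \<bullet> \<Gamma> y u v) * (\<theta> i y \<bullet> w)) + (\<Sum>i\<in>UNIV. (\<theta> i y \<bullet> v) * (\<theta> i y \<bullet> \<Gamma> y u w))"
begin

text \<open>Cramer's rule for the column \<open>j\<close> of the inverse of the matrix with rows \<open>\<theta> i y\<close>; this form
  makes smoothness evident.\<close>

definition frame :: "'n \<Rightarrow> real^'n \<Rightarrow> real^'n" where
  "frame j y = (\<chi> k. det (\<chi> i l. if l = k then axis j 1 $ i else \<theta> i y $ l) / det (\<chi> i. \<theta> i y))"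

text \<open>As \<open>\<theta>\<close> is orthonormal, pairing with \<open>\<theta> k\<close> is the
  inner product with \<open>frame k\<close>.\<close>

definition conn_coeff :: "'n \<Rightarrow> 'n \<Rightarrow> 'n \<Rightarrow> real^'n \<Rightarrow> real" where
  "conn_coeff s j k y = \<theta> k y \<bullet> cov_deriv \<Gamma> (frame s) (frame j) y"

text \<open>The covariant derivative of the covector \<open>\<theta> a\<close> in direction
  \<open>t\<close>, evaluated at \<open>u\<close>.\<close>

definition coframe_deriv :: "'n \<Rightarrow> real^'n \<Rightarrow> real^'n \<Rightarrow> real^'n \<Rightarrow> real" where
  "coframe_deriv a y t u = D (\<theta> a) y t \<bullet> u - \<theta> a y \<bullet> \<Gamma> y t u"

lemma det_coframe: "y \<in> V \<Longrightarrow> det (\<chi> i. \<theta> i y) \<noteq> 0"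
proof -
  assume "y \<in> V"
  note ind = independent_\<theta>[OF this]
  have "rows (\<chi> i. \<theta> i y) = range (\<lambda>i. \<theta> i y)"
    by (auto simp: rows_def row_def vec_lambda_eta)
  then have "rank (\<chi> i. \<theta> i y) = CARD('n)"
    using ind by (simp add: row_rank_def dim_eq_card_independent card_image)
  then show ?thesis by (simp add: det_eq_0_rank)
qed

lemma coframe_mult: "((\<chi> i. \<theta> i y) *v v) $ i = \<theta> i y \<bullet> v"
  by (simp add: matrix_vector_mult_def inner_vec_def)

lemma coframe_frame:
  assumes "y \<in> V"
  shows "\<theta> i y \<bullet> frame j y = (if i = j then 1 else 0)"
proof -
  have "(\<chi> i. \<theta> i y) *v frame j y = axis j 1"
    unfolding cramer[OF det_coframe[OF assms]] frame_def by (simp only: vec_lambda_beta)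
  then show ?thesis
    unfolding coframe_mult[symmetric] by (simp add: axis_def)
qed

lemma coframe_eqI:
  assumes "y \<in> V" "\<And>i. \<theta> i y \<bullet> v = \<theta> i y \<bullet> w"
  shows "v = w"
proof -
  have "(\<chi> i. \<theta> i y) *v v = (\<chi> i. \<theta> i y) *v w"
    using assms(2) by (simp add: vec_eq_iff coframe_mult)
  then show ?thesis
    using inj_matrix_vector_mult[OF iffD2[OF invertible_det_nz det_coframe[OF assms(1)]]]
    by (rule injD[rotated])
qed

lemma frame_expansion:
  assumes "y \<in> V"
  shows "v = (\<Sum>i\<in>UNIV. (\<theta> i y \<bullet> v) *\<^sub>R frame i y)"
  by (rule coframe_eqI[OF assms])
    (simp add: inner_sum_right coframe_frame[OF assms] if_distrib[of "\<lambda>x. _ * x"] cong: if_cong)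

lemma smooth_frame: "smooth_on V (frame j)"
  unfolding smooth_on_def
proof
  fix k
  have \<theta>: "Ck_on k V (\<lambda>y. \<theta> i y $ l)" for i l
    using smooth_\<theta> open_V unfolding smooth_on_def by (auto intro: Ck_on_nth)
  have "Ck_on k V (\<lambda>y. if l = m then axis j 1 $ i else \<theta> i y $ l)" for i l m
    using \<theta> Ck_on_const[OF open_V] by (cases "l = m") auto
  then have num: "Ck_on k V (\<lambda>y. det (\<chi> i l. if l = m then axis j 1 $ i else \<theta> i y $ l))" for m
    by (intro Ck_on_det[OF open_V]) simp
  have "Ck_on k V (\<lambda>y. det (\<chi> i. \<theta> i y))"
    by (intro Ck_on_det[OF open_V]) (simp add: \<theta>)
  then have "Ck_on k V (\<lambda>y. inverse (det (\<chi> i. \<theta> i y)))"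
    using det_coframe by (rule Ck_on_inverse[OF open_V])
  with num show "Ck_on k V (frame j)"
    unfolding frame_def[abs_def] divide_inverse
    by (intro Ck_on_vec[OF open_V] Ck_on_mult[OF open_V])
qed

lemma smooth_cov_deriv: "smooth_on V Y \<Longrightarrow> smooth_on V Z \<Longrightarrow> smooth_on V (cov_deriv \<Gamma> Y Z)"
  by (rule smooth_on_cov_deriv[OF open_V _ _ bilinear_\<Gamma> smooth_\<Gamma>])

lemma smooth_conn_coeff: "smooth_on V (conn_coeff s j k)"
  unfolding conn_coeff_def[abs_def]
  by (intro smooth_on_inner open_V smooth_\<theta> smooth_cov_deriv smooth_frame)

section \<open>Structure equations in the moving frame\<close>

lemma cov_deriv_frame:
  "y \<in> V \<Longrightarrow> cov_deriv \<Gamma> (frame s) (frame j) y = (\<Sum>k\<in>UNIV. conn_coeff s j k y *\<^sub>R frame k y)"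
  unfolding conn_coeff_def by (rule frame_expansion)

lemma linear_cov_deriv:
  assumes "y \<in> V" "smooth_on V Z"
  shows "linear (\<lambda>u. D Z y u + \<Gamma> y u (Z y))"
  using linear_frechet_derivative_smooth[OF assms(2,1)] bilinear_\<Gamma>[OF assms(1)]
  by (intro linear_compose_add) (auto simp: bilinear_def)

text \<open>Leibniz rule for the frame expansion of the inner derivative: the first term
  differentiates the coefficients, the sum the frame vectors.\<close>

lemma cov_deriv_cov_deriv_frame:
  assumes "x \<in> V"
  shows "\<theta> k x \<bullet> cov_deriv \<Gamma> (frame s) (cov_deriv \<Gamma> (frame i) (frame j)) x =
    D (conn_coeff i j k) x (frame s x) + (\<Sum>b\<in>UNIV. conn_coeff i j b x * conn_coeff s b k x)"
proof -
  let ?e = "frame s x"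
  have "((\<lambda>y. \<Sum>b\<in>UNIV. conn_coeff i j b y *\<^sub>R frame b y) has_derivative
      (\<lambda>t. \<Sum>b\<in>UNIV. conn_coeff i j b x *\<^sub>R D (frame b) x t + D (conn_coeff i j b) x t *\<^sub>R frame b x)) (at x)"
    by (intro has_derivative_sum has_derivative_scaleR
        smooth_on_has_derivative[OF smooth_conn_coeff assms] smooth_on_has_derivative[OF smooth_frame assms])
  then have "(cov_deriv \<Gamma> (frame i) (frame j) has_derivative
      (\<lambda>t. \<Sum>b\<in>UNIV. conn_coeff i j b x *\<^sub>R D (frame b) x t + D (conn_coeff i j b) x t *\<^sub>R frame b x)) (at x)"
    by (rule has_derivative_transform_within_open[OF _ open_V assms]) (simp add: cov_deriv_frame)
  then have d: "D (cov_deriv \<Gamma> (frame i) (frame j)) x ?e =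
      (\<Sum>b\<in>UNIV. conn_coeff i j b x *\<^sub>R D (frame b) x ?e + D (conn_coeff i j b) x ?e *\<^sub>R frame b x)"
    by (rule frechet_derivative_at[symmetric, THEN fun_cong])
  have lin: "linear (\<Gamma> x ?e)" using bilinear_\<Gamma>[OF assms] by (simp add: bilinear_def)
  have g: "\<Gamma> x ?e (cov_deriv \<Gamma> (frame i) (frame j) x) =
      (\<Sum>b\<in>UNIV. conn_coeff i j b x *\<^sub>R \<Gamma> x ?e (frame b x))"
    unfolding cov_deriv_frame[OF assms] linear_sum[OF lin] linear_cmul[OF lin] ..
  have "cov_deriv \<Gamma> (frame s) (cov_deriv \<Gamma> (frame i) (frame j)) x =
      (\<Sum>b\<in>UNIV. D (conn_coeff i j b) x ?e *\<^sub>R frame b x)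
      + (\<Sum>b\<in>UNIV. conn_coeff i j b x *\<^sub>R cov_deriv \<Gamma> (frame s) (frame b) x)"
    unfolding cov_deriv_def[of \<Gamma> "frame s"] d g
    by (simp add: sum.distrib scaleR_add_right add_ac)
  then show ?thesis
    by (simp add: inner_add_right inner_sum_right coframe_frame[OF assms] conn_coeff_def if_distrib cong: if_cong)
qed

text \<open>Cartan's second structure equation in components. The frame fields need not commute; the
  last sum comes from their bracket, expressed through vanishing torsion.\<close>

lemma curvature_frame:
  assumes "x \<in> V"
  shows "\<theta> k x \<bullet> curvature \<Gamma> (frame s) (frame i) (frame j) x =
    D (conn_coeff i j k) x (frame s x) - D (conn_coeff s j k) x (frame i x)
    + (\<Sum>b\<in>UNIV. conn_coeff i j b x * conn_coeff s b k x - conn_coeff s j b x * conn_coeff i b k x)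
    - (\<Sum>a\<in>UNIV. (conn_coeff s i a x - conn_coeff i s a x) * conn_coeff a j k x)"
proof -
  let ?L = "\<lambda>u. D (frame j) x u + \<Gamma> x u (frame j x)"
  have "lie_bracket (frame s) (frame i) x = cov_deriv \<Gamma> (frame s) (frame i) x - cov_deriv \<Gamma> (frame i) (frame s) x"
    using symmetric_\<Gamma>[OF assms, of "frame s x" "frame i x"] by (simp add: lie_bracket_def cov_deriv_def)
  also have "\<dots> = (\<Sum>a\<in>UNIV. (conn_coeff s i a x - conn_coeff i s a x) *\<^sub>R frame a x)"
    by (simp add: cov_deriv_frame[OF assms] sum_subtractf scaleR_diff_left)
  finally have "cov_deriv \<Gamma> (lie_bracket (frame s) (frame i)) (frame j) x =
      ?L (\<Sum>a\<in>UNIV. (conn_coeff s i a x - conn_coeff i s a x) *\<^sub>R frame a x)"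
    by (simp add: cov_deriv_def)
  also have "\<dots> = (\<Sum>a\<in>UNIV. (conn_coeff s i a x - conn_coeff i s a x) *\<^sub>R cov_deriv \<Gamma> (frame a) (frame j) x)"
    unfolding cov_deriv_def linear_sum[OF linear_cov_deriv[OF assms smooth_frame]]
      linear_cmul[OF linear_cov_deriv[OF assms smooth_frame]] ..
  finally have "\<theta> k x \<bullet> cov_deriv \<Gamma> (lie_bracket (frame s) (frame i)) (frame j) x =
      (\<Sum>a\<in>UNIV. (conn_coeff s i a x - conn_coeff i s a x) * conn_coeff a j k x)"
    by (simp add: inner_sum_right conn_coeff_def)
  then show ?thesis
    unfolding curvature_def
    by (simp add: inner_diff_right inner_add_right cov_deriv_cov_deriv_frame[OF assms] sum_subtractf)
qed

text \<open>The pairing of \<open>\<theta> a\<close> with \<open>frame j\<close> is constant, so its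
  derivative vanishes.\<close>

lemma coframe_deriv_frame_gen:
  assumes "y \<in> V"
  shows "coframe_deriv a y t (frame j y) = - (\<theta> a y \<bullet> (D (frame j) y t + \<Gamma> y t (frame j y)))"
proof -
  have "((\<lambda>z. \<theta> a z \<bullet> frame j z) has_derivative
      (\<lambda>t. \<theta> a y \<bullet> D (frame j) y t + D (\<theta> a) y t \<bullet> frame j y)) (at y)"
    by (intro has_derivative_inner smooth_on_has_derivative[OF smooth_\<theta> assms]
        smooth_on_has_derivative[OF smooth_frame assms])
  then have "((\<lambda>z. if a = j then 1 else 0) has_derivative
      (\<lambda>t. \<theta> a y \<bullet> D (frame j) y t + D (\<theta> a) y t \<bullet> frame j y)) (at y)"
    by (rule has_derivative_transform_within_open[OF _ open_V assms]) (simp add: coframe_frame)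
  then have "(\<lambda>t. \<theta> a y \<bullet> D (frame j) y t + D (\<theta> a) y t \<bullet> frame j y) = (\<lambda>t. 0)"
    by (rule has_derivative_unique[OF _ has_derivative_const])
  then have "\<theta> a y \<bullet> D (frame j) y t + D (\<theta> a) y t \<bullet> frame j y = 0" by metis
  then show ?thesis unfolding coframe_deriv_def by (simp add: inner_add_right)
qed

lemma coframe_deriv_frame:
  "y \<in> V \<Longrightarrow> coframe_deriv a y (frame s y) (frame j y) = - conn_coeff s j a y"
  by (simp add: coframe_deriv_frame_gen conn_coeff_def cov_deriv_def)

lemma has_derivative_coframe_inner:
  "y \<in> V \<Longrightarrow> ((\<lambda>z. \<theta> i z \<bullet> v) has_derivative (\<lambda>t. D (\<theta> i) y t \<bullet> v)) (at y)"
  by (rule has_derivative_inner_left[OF smooth_on_has_derivative[OF smooth_\<theta>]])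

lemma conn_coeff_skew:
  assumes "y \<in> V"
  shows "conn_coeff s j k y = - conn_coeff s k j y"
proof -
  \<comment> \<open>The vectors are frozen at \<open>y\<close>, so differentiating the metric on
    them differentiates only the coframe.\<close>
  let ?u = "frame s y" and ?v = "frame j y" and ?w = "frame k y"
  have "((\<lambda>z. \<Sum>i\<in>UNIV. (\<theta> i z \<bullet> ?v) * (\<theta> i z \<bullet> ?w)) has_derivative
      (\<lambda>t. \<Sum>i\<in>UNIV. (\<theta> i y \<bullet> ?v) * (D (\<theta> i) y t \<bullet> ?w) + (D (\<theta> i) y t \<bullet> ?v) * (\<theta> i y \<bullet> ?w))) (at y)"
    by (intro has_derivative_sum has_derivative_mult has_derivative_coframe_inner assms)
  then have "D (\<lambda>z. \<Sum>i\<in>UNIV. (\<theta> i z \<bullet> ?v) * (\<theta> i z \<bullet> ?w)) y ?u =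
      (\<Sum>i\<in>UNIV. (\<theta> i y \<bullet> ?v) * (D (\<theta> i) y ?u \<bullet> ?w) + (D (\<theta> i) y ?u \<bullet> ?v) * (\<theta> i y \<bullet> ?w))"
    by (rule frechet_derivative_at[symmetric, THEN fun_cong])
  then have "(\<Sum>i\<in>UNIV. coframe_deriv i y ?u ?v * (\<theta> i y \<bullet> ?w))
      + (\<Sum>i\<in>UNIV. (\<theta> i y \<bullet> ?v) * coframe_deriv i y ?u ?w) = 0"
    unfolding metric_\<Gamma>[OF assms] coframe_deriv_def
    by (simp add: left_diff_distrib right_diff_distrib sum_subtractf sum.distrib)
  then show ?thesis
    by (simp add: coframe_frame[OF assms] coframe_deriv_frame[OF assms]
        if_distrib[of "\<lambda>x. _ * x"] if_distrib[of "\<lambda>x. x * _"] sum_negf cong: if_cong)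
qed

lemma deriv_conn_coeff_skew:
  assumes "x \<in> V"
  shows "D (conn_coeff s j k) x t = - D (conn_coeff s k j) x t"
proof -
  have "((\<lambda>y. - conn_coeff s k j y) has_derivative (\<lambda>t. - D (conn_coeff s k j) x t)) (at x)"
    by (intro has_derivative_minus smooth_on_has_derivative[OF smooth_conn_coeff assms])
  then have "(conn_coeff s j k has_derivative (\<lambda>t. - D (conn_coeff s k j) x t)) (at x)"
    by (rule has_derivative_transform_within_open[OF _ open_V assms]) (simp add: conn_coeff_skew[of _ s j k])
  then show ?thesis by (rule frechet_derivative_at[symmetric, THEN fun_cong])
qed

lemma frame_induct_linear:
  assumes "y \<in> V" "linear f" "\<And>i. f (frame i y) = 0"
  shows "f v = 0"
  using frame_expansion[OF assms(1), of v] assms(2,3)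
  by (metis (no_types, lifting) linear_cmul linear_sum scaleR_zero_right sum.neutral)

lemma linear_coframe_deriv:
  assumes "y \<in> V"
  shows "linear (\<lambda>t. coframe_deriv a y t u)" "linear (\<lambda>u. coframe_deriv a y t u)"
proof -
  have "linear (D (\<theta> a) y)" by (rule linear_frechet_derivative_smooth[OF smooth_\<theta> assms])
  then show "linear (\<lambda>t. coframe_deriv a y t u)" "linear (\<lambda>u. coframe_deriv a y t u)"
    using bilinear_\<Gamma>[OF assms] unfolding coframe_deriv_def
    by (auto intro!: linearI simp: linear_add linear_cmul bilinear_ladd bilinear_radd
        bilinear_lmul bilinear_rmul inner_add_left inner_add_right algebra_simps)
qed

lemma bianchi_frame:
  assumes "x \<in> V"
  shows "curvature \<Gamma> (frame s) (frame i) (frame j) x + curvature \<Gamma> (frame i) (frame j) (frame s) x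
    + curvature \<Gamma> (frame j) (frame s) (frame i) x = 0"
  by (rule first_bianchi[OF open_V assms smooth_frame smooth_frame smooth_frame
        bilinear_\<Gamma> smooth_\<Gamma> symmetric_\<Gamma>])

end

section \<open>Closed \<open>G\<^sub>2\<close>-structures\<close>

text \<open>The arguments are arbitrary component functions, so derivatives of the coframe can be
  inserted as well as its values.\<close>

definition fano_form :: "(7 \<Rightarrow> real) \<Rightarrow> (7 \<Rightarrow> real) \<Rightarrow> (7 \<Rightarrow> real) \<Rightarrow> real" where
  "fano_form x y z = (\<Sum>a\<in>UNIV. \<Sum>b\<in>UNIV. \<Sum>c\<in>UNIV. fano a b c * (x a * y b * z c))"

lemma G2_form_eq_fano_form:
  "G2_form \<theta> u v w = fano_form (\<lambda>a. \<theta> a \<bullet> u) (\<lambda>b. \<theta> b \<bullet> v) (\<lambda>c. \<theta> c \<bullet> w)"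
proof -
  \<comment> \<open>\<open>G2_form\<close> uses the numeral 7, while \<open>fano\<close> uses
    \<open>0\<close> for the same element.\<close>
  have seven: "(7::7) = 0" by simp
  show ?thesis
    unfolding fano_form_def
    by (simp only: sum_7 fano_table neq_7 of_bool_eq simp_thms)
      (simp add: G2_form_def wedge3_def det_3 seven algebra_simps)
qed

lemma fano_form_diff:
  "fano_form (\<lambda>a. x a - x' a) y z = fano_form x y z - fano_form x' y z"
  "fano_form x (\<lambda>a. y a - y' a) z = fano_form x y z - fano_form x y' z"
  "fano_form x y (\<lambda>a. z a - z' a) = fano_form x y z - fano_form x y z'"
  unfolding fano_form_def by (simp_all add: sum_subtractf algebra_simps)

lemma fano_form_delta:
  "fano_form x (\<lambda>b. if b = j then 1 else 0) (\<lambda>c. if c = k then 1 else 0) = (\<Sum>a\<in>UNIV. x a * fano a j k)"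
  "fano_form (\<lambda>a. if a = i then 1 else 0) y (\<lambda>c. if c = k then 1 else 0) = (\<Sum>a\<in>UNIV. y a * fano i a k)"
  "fano_form (\<lambda>a. if a = i then 1 else 0) (\<lambda>b. if b = j then 1 else 0) z = (\<Sum>a\<in>UNIV. z a * fano i j a)"
proof -
  have e: "(if p then 1 else 0) * r = (if p then r else 0)" "r * (if p then 1 else 0) = (if p then r else 0)"
    "r * (if p then s else 0) = (if p then r * s else 0)" "(if p then s else 0) * r = (if p then s * r else 0)" for p and r s :: real
    by auto
  have s: "(\<Sum>c\<in>(UNIV::7 set). if p then f c else 0) = (if p then \<Sum>c\<in>UNIV. f c else (0::real))" for p f
    by auto
  show "fano_form x (\<lambda>b. if b = j then 1 else 0) (\<lambda>c. if c = k then 1 else 0) = (\<Sum>a\<in>UNIV. x a * fano a j k)"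
    "fano_form (\<lambda>a. if a = i then 1 else 0) y (\<lambda>c. if c = k then 1 else 0) = (\<Sum>a\<in>UNIV. y a * fano i a k)"
    "fano_form (\<lambda>a. if a = i then 1 else 0) (\<lambda>b. if b = j then 1 else 0) z = (\<Sum>a\<in>UNIV. z a * fano i j a)"
    unfolding fano_form_def by (simp_all add: e s mult.commute)
qed

lemma linear_fano_form:
  assumes "\<And>a. linear (\<lambda>u. f u a)"
  shows "linear (\<lambda>u. fano_form (f u) y z)" "linear (\<lambda>u. fano_form x (f u) z)"
    "linear (\<lambda>u. fano_form x y (f u))"
  unfolding fano_form_def
  by (auto intro!: linearI simp: linear_add[OF assms] linear_cmul[OF assms] sum.distrib
      sum_distrib_left algebra_simps)

lemma has_derivative_fano_der:
  assumes "\<And>i a. ((\<lambda>y. G y i a) has_derivative G' i a) (at x)"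
  shows "((\<lambda>y. fano_der (G y) i j k) has_derivative (\<lambda>h. fano_der (\<lambda>i a. G' i a h) i j k)) (at x)"
  unfolding fano_der_def
  by (intro has_derivative_sum has_derivative_add has_derivative_mult_left assms)

locale closed_G2_coframe = moving_coframe V \<theta> \<Gamma>
  for V :: "(real^7) set" and \<theta> \<Gamma> +
  fixes \<phi> :: "real^7 \<Rightarrow> real^7 \<Rightarrow> real^7 \<Rightarrow> real^7 \<Rightarrow> real"
  assumes \<phi>_eq: "\<And>y u v w. y \<in> V \<Longrightarrow> \<phi> y u v w = G2_form (\<lambda>i. \<theta> i y) u v w"
    and \<phi>_skew: "\<And>y u v w. y \<in> V \<Longrightarrow> \<phi> y v u w = - \<phi> y u v w \<and> \<phi> y u w v = - \<phi> y u v w"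
    and closed: "\<And>y t u v w. y \<in> V \<Longrightarrow> D (\<lambda>z. \<phi> z u v w) y t - D (\<lambda>z. \<phi> z t v w) y u
      + D (\<lambda>z. \<phi> z t u w) y v - D (\<lambda>z. \<phi> z t u v) y w = 0"
begin

definition form_deriv :: "real^7 \<Rightarrow> real^7 \<Rightarrow> real^7 \<Rightarrow> real^7 \<Rightarrow> real^7 \<Rightarrow> real" where
  "form_deriv y t u v w = D (\<lambda>z. \<phi> z u v w) y t
     - \<phi> y (\<Gamma> y t u) v w - \<phi> y u (\<Gamma> y t v) w - \<phi> y u v (\<Gamma> y t w)"

lemma \<phi>_fano: "y \<in> V \<Longrightarrow> \<phi> y u v w = fano_form (\<lambda>a. \<theta> a y \<bullet> u) (\<lambda>b. \<theta> b y \<bullet> v) (\<lambda>c. \<theta> c y \<bullet> w)"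
  by (simp add: \<phi>_eq G2_form_eq_fano_form)

lemma \<phi>_frame: "y \<in> V \<Longrightarrow> \<phi> y (frame i y) (frame j y) (frame k y) = fano i j k"
  by (simp add: \<phi>_fano coframe_frame fano_form_delta if_distrib[of "\<lambda>x. x * _"] cong: if_cong)

text \<open>The form is a polynomial in the coframe with constant coefficients. By the Leibniz rule
  its covariant derivative falls on one coframe factor at a time.\<close>

lemma form_deriv_eq:
  assumes "y \<in> V"
  shows "form_deriv y t u v w =
      fano_form (\<lambda>a. coframe_deriv a y t u) (\<lambda>b. \<theta> b y \<bullet> v) (\<lambda>c. \<theta> c y \<bullet> w)
    + fano_form (\<lambda>a. \<theta> a y \<bullet> u) (\<lambda>b. coframe_deriv b y t v) (\<lambda>c. \<theta> c y \<bullet> w)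
    + fano_form (\<lambda>a. \<theta> a y \<bullet> u) (\<lambda>b. \<theta> b y \<bullet> v) (\<lambda>c. coframe_deriv c y t w)"
proof -
  have "((\<lambda>z. \<Sum>a\<in>UNIV. \<Sum>b\<in>UNIV. \<Sum>c\<in>UNIV. fano a b c * ((\<theta> a z \<bullet> u) * (\<theta> b z \<bullet> v) * (\<theta> c z \<bullet> w)))
     has_derivative (\<lambda>t. \<Sum>a\<in>UNIV. \<Sum>b\<in>UNIV. \<Sum>c\<in>UNIV. fano a b c *
       ((\<theta> a y \<bullet> u) * (\<theta> b y \<bullet> v) * (D (\<theta> c) y t \<bullet> w)
        + ((\<theta> a y \<bullet> u) * (D (\<theta> b) y t \<bullet> v) + (D (\<theta> a) y t \<bullet> u) * (\<theta> b y \<bullet> v)) * (\<theta> c y \<bullet> w)))) (at y)"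
    by (intro has_derivative_sum has_derivative_mult_right has_derivative_mult
        has_derivative_coframe_inner assms)
  then have "((\<lambda>z. \<phi> z u v w) has_derivative (\<lambda>t. \<Sum>a\<in>UNIV. \<Sum>b\<in>UNIV. \<Sum>c\<in>UNIV. fano a b c *
       ((\<theta> a y \<bullet> u) * (\<theta> b y \<bullet> v) * (D (\<theta> c) y t \<bullet> w)
        + ((\<theta> a y \<bullet> u) * (D (\<theta> b) y t \<bullet> v) + (D (\<theta> a) y t \<bullet> u) * (\<theta> b y \<bullet> v)) * (\<theta> c y \<bullet> w)))) (at y)"
    by (rule has_derivative_transform_within_open[OF _ open_V assms]) (simp add: \<phi>_fano fano_form_def)
  then have "D (\<lambda>z. \<phi> z u v w) y t = (\<Sum>a\<in>UNIV. \<Sum>b\<in>UNIV. \<Sum>c\<in>UNIV. fano a b c *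
       ((\<theta> a y \<bullet> u) * (\<theta> b y \<bullet> v) * (D (\<theta> c) y t \<bullet> w)
        + ((\<theta> a y \<bullet> u) * (D (\<theta> b) y t \<bullet> v) + (D (\<theta> a) y t \<bullet> u) * (\<theta> b y \<bullet> v)) * (\<theta> c y \<bullet> w)))"
    by (rule frechet_derivative_at[symmetric, THEN fun_cong])
  also have "\<dots> = fano_form (\<lambda>a. D (\<theta> a) y t \<bullet> u) (\<lambda>b. \<theta> b y \<bullet> v) (\<lambda>c. \<theta> c y \<bullet> w)
    + fano_form (\<lambda>a. \<theta> a y \<bullet> u) (\<lambda>b. D (\<theta> b) y t \<bullet> v) (\<lambda>c. \<theta> c y \<bullet> w)
    + fano_form (\<lambda>a. \<theta> a y \<bullet> u) (\<lambda>b. \<theta> b y \<bullet> v) (\<lambda>c. D (\<theta> c) y t \<bullet> w)"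
    unfolding fano_form_def sum.distrib[symmetric]
    by (intro sum.cong refl) (simp only: algebra_simps)
  finally show ?thesis
    unfolding form_deriv_def coframe_deriv_def \<phi>_fano[OF assms] fano_form_diff by simp
qed

text \<open>The components of the form are constant, so only the connection matrix contributes; the
  sign comes from passing from vectors to covectors.\<close>

lemma form_deriv_frame:
  assumes "y \<in> V"
  shows "form_deriv y (frame t y) (frame i y) (frame j y) (frame k y) =
    - fano_der (\<lambda>i a. conn_coeff t i a y) i j k"
  unfolding form_deriv_eq[OF assms] coframe_deriv_frame[OF assms] coframe_frame[OF assms]
    fano_form_delta fano_der_def
  by (simp add: sum.distrib sum_negf)

text \<open>For a torsion-free connection the exterior derivative is the alternation of the
  covariant derivative: the Christoffel terms cancel by symmetry.\<close>

lemma form_deriv_alternating: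
  assumes "y \<in> V"
  shows "form_deriv y t u v w - form_deriv y u t v w + form_deriv y v t u w - form_deriv y w t u v = 0"
proof -
  note sk = \<phi>_skew[OF assms, THEN conjunct1] \<phi>_skew[OF assms, THEN conjunct2]
  have cyc: "\<phi> y a b c = \<phi> y b c a" for a b c
    using sk(1)[of a b c] sk(2)[of b a c] by simp
  show ?thesis
    unfolding form_deriv_def
    using closed[OF assms, of u v w t]
      symmetric_\<Gamma>[OF assms, of t u] symmetric_\<Gamma>[OF assms, of t v] symmetric_\<Gamma>[OF assms, of t w]
      symmetric_\<Gamma>[OF assms, of u v] symmetric_\<Gamma>[OF assms, of u w] symmetric_\<Gamma>[OF assms, of v w]
      sk(1)[of u "\<Gamma> y t v" w] cyc[of "\<Gamma> y t w" u v]
      sk(2)[of t v "\<Gamma> y u w"] sk(1)[of t]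
    by simp
qed

lemma fano_closed_conn_coeff:
  assumes "y \<in> V"
  shows "fano_der (\<lambda>i a. conn_coeff t i a y) i j k - fano_der (\<lambda>b a. conn_coeff i b a y) t j k
     + fano_der (\<lambda>i a. conn_coeff j i a y) t i k - fano_der (\<lambda>i a. conn_coeff k i a y) t i j = 0"
  using form_deriv_alternating[OF assms, of "frame t y" "frame i y" "frame j y" "frame k y"]
  unfolding form_deriv_frame[OF assms] by simp

text \<open>Closedness holds on all of the open set \<open>V\<close>, so its frame components may be
  differentiated.\<close>

lemma fano_closed_deriv_conn_coeff:
  assumes "x \<in> V"
  shows "fano_der (\<lambda>i a. D (conn_coeff t i a) x h) i j k - fano_der (\<lambda>b a. D (conn_coeff i b a) x h) t j k
     + fano_der (\<lambda>i a. D (conn_coeff j i a) x h) t i k - fano_der (\<lambda>i a. D (conn_coeff k i a) x h) t i j = 0"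
proof -
  have "((\<lambda>y. fano_der (\<lambda>i a. conn_coeff t i a y) i j k - fano_der (\<lambda>b a. conn_coeff i b a y) t j k
     + fano_der (\<lambda>i a. conn_coeff j i a y) t i k - fano_der (\<lambda>i a. conn_coeff k i a y) t i j) has_derivative
     (\<lambda>h. fano_der (\<lambda>i a. D (conn_coeff t i a) x h) i j k - fano_der (\<lambda>b a. D (conn_coeff i b a) x h) t j k
     + fano_der (\<lambda>i a. D (conn_coeff j i a) x h) t i k - fano_der (\<lambda>i a. D (conn_coeff k i a) x h) t i j)) (at x)"
    by (intro has_derivative_diff has_derivative_add has_derivative_fano_der
        smooth_on_has_derivative[OF smooth_conn_coeff assms])
  then have "((\<lambda>y. 0) has_derivative
     (\<lambda>h. fano_der (\<lambda>i a. D (conn_coeff t i a) x h) i j k - fano_der (\<lambda>b a. D (conn_coeff i b a) x h) t j k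
     + fano_der (\<lambda>i a. D (conn_coeff j i a) x h) t i k - fano_der (\<lambda>i a. D (conn_coeff k i a) x h) t i j)) (at x)"
    by (rule has_derivative_transform_within_open[OF _ open_V assms]) (rule fano_closed_conn_coeff)
  from has_derivative_unique[OF this has_derivative_const] show ?thesis by (rule fun_cong)
qed

lemma form_deriv_eq_0I:
  assumes "x \<in> V"
    and "\<And>t i j k. form_deriv x (frame t x) (frame i x) (frame j x) (frame k x) = 0"
  shows "form_deriv x t u v w = 0"
proof -
  have lin: "linear (\<lambda>t. form_deriv x t u v w)" "linear (\<lambda>u. form_deriv x t u v w)"
    "linear (\<lambda>v. form_deriv x t u v w)" "linear (\<lambda>w. form_deriv x t u v w)" for t u v w
    unfolding form_deriv_eq[OF assms(1)]
    by (intro linear_compose_add linear_fano_form linear_coframe_deriv assms(1)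
        bounded_linear.linear bounded_linear_inner_right)+
  \<comment> \<open>The arguments are released from the frame one at a time, the last one
    first.\<close>
  have "form_deriv x (frame t x) (frame i x) (frame j x) w = 0" for t i j w
    by (rule frame_induct_linear[OF assms(1) lin(4)]) (rule assms(2))
  then have "form_deriv x (frame t x) (frame i x) v w = 0" for t i v w
    by (rule frame_induct_linear[OF assms(1) lin(3)])
  then have "form_deriv x (frame t x) u v w = 0" for t u v w
    by (rule frame_induct_linear[OF assms(1) lin(2)])
  then show ?thesis
    by (rule frame_induct_linear[OF assms(1) lin(1)])
qed

text \<open>Feeds the frame components into the pointwise algebra; \<open>\<kappa>\<close> and
  \<open>\<mu>\<close> belong to the single point \<open>x\<close>.\<close>

lemma form_deriv_eq_0:
  assumes "x \<in> V"
    and einstein: "\<And>i j. (\<Sum>s\<in>UNIV. \<theta> s x \<bullet> curvature \<Gamma> (frame s) (frame i) (frame j) x) = (if i = j then \<kappa> else 0)"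
    and star: "\<And>s m. (\<Sum>i\<in>UNIV. \<Sum>j\<in>UNIV. \<Sum>k\<in>UNIV. \<Sum>l\<in>UNIV.
      (\<theta> l x \<bullet> curvature \<Gamma> (frame i) (frame j) (frame k) x) * fano i j s * fano k l m) = (if s = m then \<mu> else 0)"
  shows "form_deriv x t u v w = 0"
proof (rule form_deriv_eq_0I[OF assms(1)])
  fix t i j k
  have "fano_der (\<lambda>i a. conn_coeff t i a x) i j k = 0"
  proof (rule closed_einstein_star_einstein[where \<Gamma> = "\<lambda>t i j. conn_coeff t i j x"
        and R = "\<lambda>s i j k. \<theta> k x \<bullet> curvature \<Gamma> (frame s) (frame i) (frame j) x"
        and d\<Gamma> = "\<lambda>s i j k. D (conn_coeff i j k) x (frame s x)"])
    show "(\<theta> k x \<bullet> curvature \<Gamma> (frame s) (frame i) (frame j) x)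
        + (\<theta> k x \<bullet> curvature \<Gamma> (frame i) (frame j) (frame s) x)
        + (\<theta> k x \<bullet> curvature \<Gamma> (frame j) (frame s) (frame i) x) = 0" for s i j k
      unfolding inner_add_right[symmetric] bianchi_frame[OF assms(1)] by simp
  qed (fact curvature_frame[OF assms(1)] conn_coeff_skew[OF assms(1)] deriv_conn_coeff_skew[OF assms(1)]
      fano_closed_conn_coeff[OF assms(1)] fano_closed_deriv_conn_coeff[OF assms(1)] einstein star)+
  then show "form_deriv x (frame t x) (frame i x) (frame j x) (frame k x) = 0"
    by (simp add: form_deriv_frame[OF assms(1)])
qed

end

section \<open>From adapted coframes to the charts of the manifold\<close>

theorem theorem5p7:
  fixes X :: "'a topology"
    and A :: "('a, 7) chart set"
    and \<omega> :: "('a, 7) tensor3"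
    and g :: "('a, 7) tensor2"
    and \<Gamma> :: "('a, 7) conn"
  assumes "smooth_manifold X A"
    and "G2_structure A \<omega>"
    and "induced_metric A \<omega> g"
    and "levi_civita A g \<Gamma>"
    and "closed_3form A \<omega>"
    and "einstein A g \<Gamma>"
    and "star_einstein A \<omega> g \<Gamma>"
  shows "parallel_3form A \<Gamma> \<omega>"
  unfolding parallel_3form_def
proof (intro ballI allI)
  fix c x t u v w
  assume c: "c \<in> A" and x: "x \<in> img c"
  note metric = assms(3)[unfolded induced_metric_def riemannian_metric_def]
  note connection = assms(4)[unfolded levi_civita_def affine_connection_def]
  \<comment> \<open>The coframe has to be adapted to \<open>\<omega>\<close> and orthonormal for
    \<open>g\<close> at the same time.\<close>
  obtain V \<theta> where V\<theta>: "x \<in> V \<and> adapted_coframe_on \<omega> c V \<theta> \<and>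
      (\<forall>y\<in>V. \<forall>u v. g c y u v = (\<Sum>i\<in>UNIV. (\<theta> i y \<bullet> u) * (\<theta> i y \<bullet> v)))"
    using metric[THEN conjunct2, rule_format, OF c x] by (elim exE)
  then have xV: "x \<in> V" and V: "adapted_coframe_on \<omega> c V \<theta>"
    by simp_all
  have g: "g c y u v = (\<Sum>i\<in>UNIV. (\<theta> i y \<bullet> u) * (\<theta> i y \<bullet> v))" if "y \<in> V" for y u v
    using V\<theta>[THEN conjunct2, THEN conjunct2, rule_format, OF that] .
  have open_V: "open V" and sub: "V \<subseteq> img c"
    using V by (simp_all add: adapted_coframe_on_def)
  have smooth_g: "smooth_on (img c) (\<lambda>y. g c y u v)" for u v
    by (rule metric[THEN conjunct1, THEN conjunct2, THEN conjunct1, rule_format, OF c])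
  interpret closed_G2_coframe V \<theta> "\<Gamma> c" "\<omega> c"
  proof
    show "open V" by (rule open_V)
    show "smooth_on V (\<theta> i)" for i
      using V by (simp add: adapted_coframe_on_def)
    show "inj (\<lambda>i. \<theta> i y) \<and> independent (range (\<lambda>i. \<theta> i y))" if "y \<in> V" for y
      using V that by (simp add: adapted_coframe_on_def)
    show "bilinear (\<Gamma> c y)" if "y \<in> V" for y
      by (rule connection[THEN conjunct1, THEN conjunct1, rule_format, OF c subsetD[OF sub that]])
    show "smooth_on V (\<lambda>y. \<Gamma> c y u v)" for u v
      using connection[THEN conjunct1, THEN conjunct2, THEN conjunct1, rule_format, OF c, of u v] sub
      unfolding smooth_on_def by (auto intro: Ck_on_subset)
    show "\<Gamma> c y u v = \<Gamma> c y v u" if "y \<in> V" for y u v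
      by (rule connection[THEN conjunct2, THEN conjunct2, rule_format, OF c subsetD[OF sub that]])
    show "D (\<lambda>z. \<Sum>i\<in>UNIV. (\<theta> i z \<bullet> v) * (\<theta> i z \<bullet> w)) y u =
      (\<Sum>i\<in>UNIV. (\<theta> i y \<bullet> \<Gamma> c y u v) * (\<theta> i y \<bullet> w)) + (\<Sum>i\<in>UNIV. (\<theta> i y \<bullet> v) * (\<theta> i y \<bullet> \<Gamma> c y u w))"
      if "y \<in> V" for y u v w
    proof -
      \<comment> \<open>Compatibility is known for \<open>g\<close>; it transfers because
        \<open>g\<close> agrees with the sum of squares on the open set \<open>V\<close>.\<close>
      have "(\<lambda>z. g c z v w) differentiable (at y)"
        using smooth_on_has_derivative[OF smooth_g subsetD[OF sub that]]
        by (auto simp: differentiable_def)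
      then have "frechet_derivative (\<lambda>z. g c z v w) (at y) =
          frechet_derivative (\<lambda>z. \<Sum>i\<in>UNIV. (\<theta> i z \<bullet> v) * (\<theta> i z \<bullet> w)) (at y)"
        by (rule frechet_derivative_transform_within_open[OF _ open_V that]) (rule g)
      moreover have "D (\<lambda>z. g c z v w) y u = g c y (\<Gamma> c y u v) w + g c y v (\<Gamma> c y u w)"
        by (rule connection[THEN conjunct2, THEN conjunct1, rule_format, OF c subsetD[OF sub that]])
      ultimately show ?thesis using g[OF that] by simp
    qed
    show "\<omega> c y u v w = G2_form (\<lambda>i. \<theta> i y) u v w" if "y \<in> V" for y u v w
      using V that by (simp add: adapted_coframe_on_def)
    show "\<omega> c y v u w = - \<omega> c y u v w \<and> \<omega> c y u w v = - \<omega> c y u v w" if "y \<in> V" for y u v w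
      by (rule assms(2)[unfolded G2_structure_def differential_3form_def, THEN conjunct1, THEN conjunct1,
          rule_format, OF c subsetD[OF sub that], THEN conjunct2])
    show "D (\<lambda>z. \<omega> c z u v w) y t - D (\<lambda>z. \<omega> c z t v w) y u
      + D (\<lambda>z. \<omega> c z t u w) y v - D (\<lambda>z. \<omega> c z t u v) y w = 0" if "y \<in> V" for y t u v w
      by (rule assms(5)[unfolded closed_3form_def ext_deriv_def, rule_format, OF c subsetD[OF sub that]])
  qed
  have g_frame: "g c y a (frame k y) = \<theta> k y \<bullet> a" if "y \<in> V" for y a k
    by (simp add: g[OF that] coframe_frame[OF that] if_distrib[of "\<lambda>x. _ * x"] cong: if_cong)
  have riem: "riem g \<Gamma> c frame x s i j k = \<theta> k x \<bullet> curvature (\<Gamma> c) (frame s) (frame i) (frame j) x" for s i j k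
    by (simp add: riem_def g_frame[OF xV])
  \<comment> \<open>The frame dual to an orthonormal coframe is orthonormal, so both Einstein
    conditions apply to it.\<close>
  have orthonormal: "orthonormal_frame_on g c V frame"
    unfolding orthonormal_frame_on_def
    using open_V sub smooth_frame by (simp add: g_frame coframe_frame)
  have "form_deriv x t u v w = 0"
  proof (rule form_deriv_eq_0[OF xV])
    fix i j
    have "ricci g \<Gamma> c frame x i j - scalar_curv g \<Gamma> c frame x / real CARD(7) * g c x (frame i x) (frame j x) = 0"
      by (rule assms(6)[unfolded einstein_def, rule_format, OF c orthonormal xV])
    then show "(\<Sum>s\<in>UNIV. \<theta> s x \<bullet> curvature (\<Gamma> c) (frame s) (frame i) (frame j) x) =
        (if i = j then scalar_curv g \<Gamma> c frame x / 7 else 0)"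
      by (auto simp: ricci_def riem g_frame[OF xV] coframe_frame[OF xV])
  next
    fix s m
    have "star_ricci \<omega> g \<Gamma> c frame x s m =
        star_scalar_curv \<omega> g \<Gamma> c frame x / 7 * g c x (frame s x) (frame m x)"
      by (rule assms(7)[unfolded star_einstein_def, rule_format, OF c orthonormal xV])
    then show "(\<Sum>i\<in>UNIV. \<Sum>j\<in>UNIV. \<Sum>k\<in>UNIV. \<Sum>l\<in>UNIV.
        (\<theta> l x \<bullet> curvature (\<Gamma> c) (frame i) (frame j) (frame k) x) * fano i j s * fano k l m) =
        (if s = m then star_scalar_curv \<omega> g \<Gamma> c frame x / 7 else 0)"
      by (auto simp: star_ricci_def riem \<phi>_frame[OF xV] g_frame[OF xV] coframe_frame[OF xV])
  qed
  then show "cov_deriv_3form \<Gamma> \<omega> c x t u v w = 0"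
    unfolding form_deriv_def cov_deriv_3form_def .
qed

end
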